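(* Fix an integer $n\geq 1$. (1) The sets $LPM_n(\epsilon)$, $\epsilon\in\{\pm1\}^n$, are nonempty and pairwise disjoint, and their union $LPM_n$ is open and dense in the space of all real symmetric $n\times n$ matrices. More strongly, given any $A=A^T\in\mathbb{R}^{n\times n}$, there exist a sign pattern $\epsilon\in\{\pm1\}^n$ and a sequence of matrices $A_m\in LPM_n(\epsilon)$ (the same $\epsilon$ for all $m$) such that $A_m\to A$ entrywise. (2) Given any sign pattern $\epsilon\in\{\pm1\}^n$ and any matrix $B_\epsilon\in LPM_n(\epsilon)$, the map $$\Phi_{B_\epsilon}:\mathbf{L}_n\to LPM_n(\epsilon),\qquad L\mapsto L\,B_\epsilon\,L^T$$ is (well defined and) a $C^\infty$ diffeomorphism of $\mathbf{L}_n$ onto $LPM_n(\epsilon)$, whose inverse $\Phi_{B_\epsilon}^{-1}$ is algorithmic; hence it preserves the families of Borel sets and of Lebesgue measurable sets.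
   Context: For $\epsilon=(\epsilon_1,\dots,\epsilon_n)\in\{\pm1\}^n$, $LPM_n(\epsilon)$ is the set of real symmetric $n\times n$ matrices $A$ such that for every $1\le k\le n$ the leading principal $k\times k$ minor of $A$ is nonzero and has sign $\epsilon_k$; $LPM_n=\bigsqcup_{\epsilon\in\{\pm1\}^n}LPM_n(\epsilon)$. $\mathbf{L}_n$ (Cholesky space) is the set of real lower triangular $n\times n$ matrices with positive diagonal entries. $\mathbf{L}_n$ is an open subset of the $\frac{n(n+1)}2$-dimensional real vector space of lower triangular matrices, and $LPM_n(\epsilon)$ is an open subset of the $\frac{n(n+1)}2$-dimensional real vector space of symmetric matrices; smooth structures, Borel sets and Lebesgue sets refer to these. "Algorithmic" means: the entries of $L=\Phi_{B_\epsilon}^{-1}(A)$ are obtained from the entries of $A$ and $B_\epsilon$ by an explicit finite procedure using only field operations and positive square roots of positive numbers. *)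

theory Defs
  imports "HOL-Analysis.Analysis"
begin

text \<open>
  Real \<open>n \<times> n\<close> matrices are elements of \<open>real ^ 'n ^ 'n\<close> with \<open>'n :: {finite, linorder}\<close>. The size
  is \<open>n = CARD('n) \<ge> 1\<close>, and the \<open>k\<close>-th smallest element of \<open>'n\<close> plays the role of the index \<open>k\<close>.
\<close>

type_synonym 'n sqmat = "((real, 'n) vec, 'n) vec"

definition symmetric_matrices :: "('n :: finite) sqmat set" where
  "symmetric_matrices = {A. transpose A = A}"

definition lower_triangular_matrices :: "('n :: {finite, linorder}) sqmat set" where
  "lower_triangular_matrices = {L. \<forall>i j. i < j \<longrightarrow> L $ i $ j = 0}"

definition cholesky_space :: "('n :: {finite, linorder}) sqmat set" where
  "cholesky_space = {L \<in> lower_triangular_matrices. \<forall>i. L $ i $ i > 0}"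

text \<open>
  The library determinant only applies to matrices indexed by a whole type. The determinant of the
  submatrix with row and column set \<open>S\<close> is the same Leibniz sum, taken over the permutations of \<open>S\<close>.
\<close>

definition principal_minor :: "('n :: finite) set \<Rightarrow> 'n sqmat \<Rightarrow> real" where
  "principal_minor S A = (\<Sum>p | p permutes S. of_int (sign p) * (\<Prod>i\<in>S. A $ i $ p i))"

lemma principal_minor_UNIV: "principal_minor UNIV A = det A"
  by (simp add: principal_minor_def det_def)

text \<open>If \<open>k\<close> is the \<open>m\<close>-th smallest index, this is the leading principal \<open>m \<times> m\<close> minor.\<close>

definition leading_principal_minor :: "'n :: {finite, linorder} \<Rightarrow> 'n sqmat \<Rightarrow> real" where
  "leading_principal_minor k A = principal_minor {..k} A"

definition sign_patterns :: "('n \<Rightarrow> real) set" where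
  "sign_patterns = {\<epsilon>. \<forall>k. \<epsilon> k \<in> {-1, 1}}"

definition LPM :: "('n :: {finite, linorder} \<Rightarrow> real) \<Rightarrow> 'n sqmat set" where
  "LPM \<epsilon> = {A \<in> symmetric_matrices. \<forall>k.
     leading_principal_minor k A \<noteq> 0 \<and> sgn (leading_principal_minor k A) = \<epsilon> k}"

definition LPM_union :: "('n :: {finite, linorder}) sqmat set" where
  "LPM_union = (\<Union>\<epsilon>\<in>sign_patterns. LPM \<epsilon>)"

definition congruence_map :: "('n :: finite) sqmat \<Rightarrow> 'n sqmat \<Rightarrow> 'n sqmat" where
  "congruence_map B L = L ** B ** transpose L"


text \<open>
  \<open>Ck_on k V U f\<close>: \<open>f\<close> is \<open>k\<close> times continuously differentiable on \<open>U\<close>, where \<open>U\<close> is a relatively open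
  subset of the finite-dimensional subspace \<open>V\<close>. The derivative within \<open>U\<close> is a linear map on the
  ambient space, but only its restriction to \<open>V\<close> is determined by \<open>f\<close>, and only this restriction is
  differentiated further.
\<close>

primrec Ck_on ::
  "nat \<Rightarrow> 'a :: euclidean_space set \<Rightarrow> 'a set \<Rightarrow> ('a \<Rightarrow> 'b :: euclidean_space) \<Rightarrow> bool" where
  "Ck_on 0 V U f \<longleftrightarrow> continuous_on U f"
| "Ck_on (Suc k) V U f \<longleftrightarrow>
     (\<exists>f'. (\<forall>x\<in>U. (f has_derivative f' x) (at x within U)) \<and>
           (\<forall>v\<in>V. Ck_on k V U (\<lambda>x. f' x v)))"

definition smooth_on ::
  "'a :: euclidean_space set \<Rightarrow> 'a set \<Rightarrow> ('a \<Rightarrow> 'b :: euclidean_space) \<Rightarrow> bool" where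
  "smooth_on V U f \<longleftrightarrow>
     subspace V \<and> openin (top_of_set V) U \<and> (\<forall>k. Ck_on k V U f)"

definition diffeomorphism_on ::
  "'a :: euclidean_space set \<Rightarrow> 'a set \<Rightarrow> 'b :: euclidean_space set \<Rightarrow> 'b set \<Rightarrow> ('a \<Rightarrow> 'b) \<Rightarrow> bool"
  where
  "diffeomorphism_on V U W U' f \<longleftrightarrow>
     bij_betw f U U' \<and> smooth_on V U f \<and> smooth_on W U' (inv_into U f)"


text \<open>
  The entries on and below the diagonal are linear coordinates on the space of lower triangular
  matrices as well as on the space of symmetric matrices. They identify both with \<open>real ^ 'n tri\<close>,
  whose dimension is \<open>n (n + 1) / 2\<close>. As subspaces of \<open>real ^ 'n ^ 'n\<close> both are null sets when
  \<open>n \<ge> 2\<close>, so Lebesgue measurability has to be taken in these coordinates.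
\<close>

typedef (overloaded) ('n :: linorder) tri = "{(i :: 'n, j). j \<le> i}"
  morphisms tri_pair Abs_tri
  by auto

instance tri :: ("{finite, linorder}") finite
proof
  have "inj (tri_pair :: 'a tri \<Rightarrow> 'a \<times> 'a)"
    by (simp add: inj_on_def tri_pair_inject)
  then show "finite (UNIV :: 'a tri set)"
    by (rule finite_imageD[rotated]) simp
qed

definition lower_entries :: "('n :: {finite, linorder}) sqmat \<Rightarrow> (real, 'n tri) vec" where
  "lower_entries A = (\<chi> p. A $ fst (tri_pair p) $ snd (tri_pair p))"

lemma lower_entries_surj:
  fixes x :: "(real, 'n :: {finite, linorder} tri) vec"
  shows "lower_entries (\<chi> i j. if j \<le> i then x $ Abs_tri (i, j) else u i j) = x"
proof -
  have "snd (tri_pair p) \<le> fst (tri_pair p)" for p :: "'n tri"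
    using tri_pair[of p] by auto
  then show ?thesis
    by (simp add: lower_entries_def tri_pair_inverse vec_eq_iff)
qed

lemma lower_entries_eqD:
  assumes "lower_entries A = lower_entries B" "j \<le> i"
  shows "A $ i $ j = B $ i $ j"
proof -
  have "lower_entries A $ Abs_tri (i, j) = lower_entries B $ Abs_tri (i, j)"
    using assms by simp
  then show ?thesis
    using assms(2) by (simp add: lower_entries_def Abs_tri_inverse)
qed

lemma bij_lower_entries_lower_triangular:
  "bij_betw lower_entries lower_triangular_matrices UNIV"
proof (rule bij_betw_imageI)
  show "inj_on lower_entries (lower_triangular_matrices :: ('a :: {finite, linorder}) sqmat set)"
    by (rule inj_onI)
      (metis (mono_tags, lifting) lower_entries_eqD lower_triangular_matrices_def mem_Collect_eq
        not_le vec_eq_iff)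
  have "x \<in> lower_entries ` lower_triangular_matrices"
    for x :: "(real, 'a :: {finite, linorder} tri) vec"
    by (rule image_eqI[where f = lower_entries, OF lower_entries_surj[of x "\<lambda>i j. 0", symmetric]])
      (auto simp: lower_triangular_matrices_def)
  then show "lower_entries ` (lower_triangular_matrices :: ('a :: {finite, linorder}) sqmat set) = UNIV"
    by blast
qed

lemma bij_lower_entries_symmetric:
  "bij_betw lower_entries symmetric_matrices UNIV"
proof (rule bij_betw_imageI)
  show "inj_on lower_entries (symmetric_matrices :: ('a :: {finite, linorder}) sqmat set)"
  proof (rule inj_onI)
    fix A B :: "('a :: {finite, linorder}) sqmat"
    assume A: "A \<in> symmetric_matrices" and B: "B \<in> symmetric_matrices"
      and eq: "lower_entries A = lower_entries B"
    have "A $ i $ j = A $ j $ i" "B $ i $ j = B $ j $ i" for i j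
      using A B by (auto simp: symmetric_matrices_def transpose_def vec_eq_iff)
    then show "A = B"
      using lower_entries_eqD[OF eq] by (metis linear vec_eq_iff)
  qed
  have "x \<in> lower_entries ` symmetric_matrices"
    for x :: "(real, 'a :: {finite, linorder} tri) vec"
    by (rule image_eqI[where f = lower_entries, OF lower_entries_surj[of x "\<lambda>i j. x $ Abs_tri (j, i)", symmetric]])
      (auto simp: symmetric_matrices_def transpose_def vec_eq_iff)
  then show "lower_entries ` (symmetric_matrices :: ('a :: {finite, linorder}) sqmat set) = UNIV"
    by blast
qed

definition lebesgue_sets_in :: "('n :: {finite, linorder}) sqmat set \<Rightarrow> 'n sqmat set set" where
  "lebesgue_sets_in U = {S. S \<subseteq> U \<and> lower_entries ` S \<in> sets lebesgue}"

definition borel_sets_in :: "'a :: topological_space set \<Rightarrow> 'a set set" where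
  "borel_sets_in U = sets (restrict_space borel U)"


text \<open>
  Straight-line programs whose inputs are the entries of two matrices. Each instruction appends one
  number to the memory and refers to earlier results by their position; no constants other than
  0 and 1 are available. A run fails on a division by zero and on a square root of a number that is
  not positive.
\<close>

datatype 'n instr =
    Zero | One | Entry_A 'n 'n | Entry_B 'n 'n
  | Add nat nat | Sub nat nat | Mul nat nat | Div nat nat | Sqrt nat

fun exec_instr :: "('n :: finite) sqmat \<Rightarrow> 'n sqmat \<Rightarrow> real list \<Rightarrow> 'n instr \<Rightarrow> real option" where
  "exec_instr A B mem Zero = Some 0"
| "exec_instr A B mem One = Some 1"
| "exec_instr A B mem (Entry_A i j) = Some (A $ i $ j)"
| "exec_instr A B mem (Entry_B i j) = Some (B $ i $ j)"
| "exec_instr A B mem (Add a b) =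
     (if a < length mem \<and> b < length mem then Some (mem ! a + mem ! b) else None)"
| "exec_instr A B mem (Sub a b) =
     (if a < length mem \<and> b < length mem then Some (mem ! a - mem ! b) else None)"
| "exec_instr A B mem (Mul a b) =
     (if a < length mem \<and> b < length mem then Some (mem ! a * mem ! b) else None)"
| "exec_instr A B mem (Div a b) =
     (if a < length mem \<and> b < length mem \<and> mem ! b \<noteq> 0 then Some (mem ! a / mem ! b) else None)"
| "exec_instr A B mem (Sqrt a) =
     (if a < length mem \<and> mem ! a > 0 then Some (sqrt (mem ! a)) else None)"

fun run_program ::
  "('n :: finite) sqmat \<Rightarrow> 'n sqmat \<Rightarrow> 'n instr list \<Rightarrow> real list \<Rightarrow> real list option" where
  "run_program A B [] mem = Some mem"
| "run_program A B (c # cs) mem =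
     (case exec_instr A B mem c of
        None \<Rightarrow> None
      | Some x \<Rightarrow> run_program A B cs (mem @ [x]))"

text \<open>On the inputs \<open>A\<close> and \<open>B\<close>, the program \<open>P\<close> does not fail and leaves \<open>L $ i $ j\<close> at
  position \<open>out i j\<close>.\<close>

definition program_computes ::
  "('n :: finite) instr list \<Rightarrow> ('n \<Rightarrow> 'n \<Rightarrow> nat) \<Rightarrow> 'n sqmat \<Rightarrow> 'n sqmat \<Rightarrow> 'n sqmat \<Rightarrow> bool" where
  "program_computes P out A B L \<longleftrightarrow>
     (\<exists>mem. run_program A B P [] = Some mem \<and>
            (\<forall>i j. out i j < length mem \<and> mem ! out i j = L $ i $ j))"

end

theory Submission
  imports Defs
begin

text \<open>
  Gaussian elimination without pivoting succeeds on a symmetric matrix whose leading principal minors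
  are all nonzero and gives \<open>A = L\<^sub>A D\<^sub>A L\<^sub>A\<^sup>T\<close> with \<open>L\<^sub>A\<close> unit lower triangular and \<open>D\<^sub>A\<close> diagonal. The
  \<open>k\<close>-th minor is the product of the first \<open>k\<close> pivots, so for \<open>A\<close> and \<open>B\<close> with the same sign pattern
  the quotient \<open>D\<^sub>A / D\<^sub>B\<close> has positive entries, and \<open>L = L\<^sub>A (D\<^sub>A / D\<^sub>B)\<^sup>1\<^sup>/\<^sup>2 L\<^sub>B\<^sup>-\<^sup>1\<close> solves
  \<open>L B L\<^sup>T = A\<close>. The entries of \<open>L\<close> arise from those of \<open>A\<close> and \<open>B\<close> by field operations and square
  roots of positive numbers; this one fact yields both the program and the smoothness of the inverse.
  For density, each leading principal minor of \<open>A + t I\<close> vanishes for only finitely many \<open>t\<close>; as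
  there are only finitely many sign patterns, \<open>A\<close> lies in the closure of a single one of them.
\<close>

section \<open>Leading principal minors under triangular congruence\<close>

lemma card_lessThan_mono: "j < k \<Longrightarrow> card {..<j} < card {..<k}"
  for j k :: "'n :: {finite, linorder}"
  by (rule psubset_card_mono) auto

lemma card_greaterThan_mono: "k < j \<Longrightarrow> card {j<..} < card {k<..}"
  for j k :: "'n :: {finite, linorder}"
  by (rule psubset_card_mono) auto

text \<open>A finite linear order is well-founded in both directions. The sort does not include
  \<open>wellorder\<close>, so the induction measures an index by the number of indices below
  it.\<close>

lemma finite_less_induct [case_names less]:
  fixes k :: "'n :: {finite, linorder}"
  assumes "\<And>k. (\<And>j. j < k \<Longrightarrow> P j) \<Longrightarrow> P k"
  shows "P k"
proof (induction k rule: measure_induct_rule[of "\<lambda>k. card {..<k}"])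
  case (less k)
  then show ?case
    using assms card_lessThan_mono by blast
qed

text \<open>The mirror image, for back substitution that starts at the last column.\<close>

lemma finite_greater_induct [case_names greater]:
  fixes k :: "'n :: {finite, linorder}"
  assumes "\<And>k. (\<And>j. k < j \<Longrightarrow> P j) \<Longrightarrow> P k"
  shows "P k"
proof (induction k rule: measure_induct_rule[of "\<lambda>k. card {k<..}"])
  case (less k)
  then show ?case
    using assms card_greaterThan_mono by blast
qed

text \<open>Completing the block on \<open>S\<close> by the identity turns a principal minor into a
  determinant of full size, so that multiplicativity of \<open>det\<close> applies to it.\<close>

definition pad :: "'n set \<Rightarrow> 'n sqmat \<Rightarrow> ('n :: finite) sqmat" where
  "pad S A = (\<chi> i j. if i \<in> S \<and> j \<in> S then A $ i $ j else if i = j then 1 else 0)"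

text \<open>A permutation that moves an index outside \<open>S\<close> picks an off-diagonal zero of
  the padding. The remaining ones permute \<open>S\<close>, and the indices outside contribute
  factors 1.\<close>

lemma principal_minor_eq_det_pad: "principal_minor S A = det (pad S A)"
proof -
  have "det (pad S A) = (\<Sum>p | p permutes S. of_int (sign p) * (\<Prod>i\<in>UNIV. pad S A $ i $ p i))"
    unfolding det_def
  proof (rule sum.mono_neutral_right)
    show "{p. p permutes S} \<subseteq> {p. p permutes UNIV}"
      using permutes_subset by blast
    have "\<exists>i. pad S A $ i $ p i = 0" if p: "p permutes UNIV" "\<not> p permutes S" for p
    proof -
      obtain i where "i \<notin> S" "p i \<noteq> i"
        using p unfolding permutes_def by blast
      then have "pad S A $ i $ p i = 0"
        by (auto simp: pad_def)
      then show ?thesis ..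
    qed
    then show "\<forall>p\<in>{p. p permutes UNIV} - {p. p permutes S}.
        of_int (sign p) * (\<Prod>i\<in>UNIV. pad S A $ i $ p i) = 0"
      by (simp add: prod_zero_iff)
  qed (simp add: finite_permutations)
  also have "\<dots> = principal_minor S A"
    unfolding principal_minor_def
  proof (rule sum.cong)
    fix p assume "p \<in> {p. p permutes S}"
    then have p: "p permutes S" by simp
    have "(\<Prod>i\<in>UNIV. pad S A $ i $ p i) = (\<Prod>i\<in>S. pad S A $ i $ p i)"
      by (rule prod.mono_neutral_right) (use p in \<open>auto simp: pad_def permutes_def\<close>)
    also have "\<dots> = (\<Prod>i\<in>S. A $ i $ p i)"
      by (rule prod.cong) (use p in \<open>auto simp: pad_def permutes_in_image\<close>)
    finally show "of_int (sign p) * (\<Prod>i\<in>UNIV. pad S A $ i $ p i)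
        = of_int (sign p) * (\<Prod>i\<in>S. A $ i $ p i)"
      by simp
  qed simp
  finally show ?thesis ..
qed

lemma principal_minor_cong:
  assumes "\<And>i j. i \<in> S \<Longrightarrow> j \<in> S \<Longrightarrow> A $ i $ j = B $ i $ j"
  shows "principal_minor S A = principal_minor S B"
  unfolding principal_minor_def
  by (intro sum.cong arg_cong2[where f = "(*)"] prod.cong refl)
    (auto simp: permutes_in_image intro!: assms)

text \<open>If \<open>p i < i\<close>, the smaller index \<open>p i\<close> is already known to be
  fixed, so \<open>p\<close> maps both \<open>i\<close> and \<open>p i\<close> to
  \<open>p i\<close>, and injectivity gives \<open>p i = i\<close>.\<close>

lemma permutes_le_imp_id:
  fixes S :: "('n :: {finite, linorder}) set"
  assumes p: "p permutes S" and le: "\<And>i. i \<in> S \<Longrightarrow> p i \<le> i"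
  shows "p = id"
proof
  fix i
  show "p i = id i"
  proof (induction i rule: finite_less_induct)
    case (less i)
    show ?case
    proof (cases "p i < i")
      case True
      then have "p (p i) = p i" using less by simp
      then show ?thesis using permutes_inj[OF p] by (metis id_apply injD)
    next
      case False
      then show ?thesis
        using le[of i] p by (cases "i \<in> S") (auto simp: permutes_def)
    qed
  qed
qed

text \<open>Every permutation other than the identity sends some \<open>i\<close> to a larger index,
  where row \<open>i\<close> of \<open>L\<close> vanishes.\<close>

lemma principal_minor_lower_triangular:
  assumes L: "L \<in> lower_triangular_matrices"
  shows "principal_minor S L = (\<Prod>i\<in>S. L $ i $ i)"
proof -
  have "principal_minor S L = (\<Sum>p\<in>{id}. of_int (sign p) * (\<Prod>i\<in>S. L $ i $ p i))"
    unfolding principal_minor_def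
  proof (rule sum.mono_neutral_right)
    have "\<exists>i\<in>S. L $ i $ p i = 0" if p: "p permutes S" "p \<noteq> id" for p
    proof -
      obtain i where "i \<in> S" "i < p i"
        using permutes_le_imp_id[OF p(1)] p(2) not_le by blast
      then show ?thesis
        using L by (auto simp: lower_triangular_matrices_def)
    qed
    then show "\<forall>p\<in>{p. p permutes S} - {id}. of_int (sign p) * (\<Prod>i\<in>S. L $ i $ p i) = 0"
      by (simp add: prod_zero_iff)
  qed (auto simp: finite_permutations permutes_id)
  then show ?thesis by simp
qed

lemma congruence_map_nth:
  "congruence_map B L $ i $ m = (\<Sum>b\<in>UNIV. (\<Sum>a\<in>UNIV. L $ i $ a * B $ a $ b) * L $ m $ b)"
  by (simp add: congruence_map_def matrix_matrix_mult_def transpose_def)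

text \<open>For lower triangular \<open>L\<close> the leading block of \<open>L B L\<^sup>T\<close>
  is built from the leading blocks of \<open>L\<close> and \<open>B\<close> alone.\<close>

lemma pad_congruence_map:
  fixes L :: "('n :: {finite, linorder}) sqmat"
  assumes L: "L \<in> lower_triangular_matrices"
  shows "pad {..k} (congruence_map B L) = congruence_map (pad {..k} B) (pad {..k} L)"
proof -
  have up: "L $ i $ a = 0" if "i < a" for i a
    using L that by (auto simp: lower_triangular_matrices_def)
  have row: "pad {..k} L $ i $ a = L $ i $ a" if "i \<le> k" for i a
    using that up[of i a] by (auto simp: pad_def)
  have row': "pad {..k} M $ i $ a = (if a = i then 1 else 0)" if "\<not> i \<le> k" for i a M
    using that by (auto simp: pad_def)
  have col': "pad {..k} M $ a $ i = (if a = i then 1 else 0)" if "\<not> i \<le> k" for i a M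
    using that by (auto simp: pad_def)
  have "pad {..k} (congruence_map B L) $ i $ m = congruence_map (pad {..k} B) (pad {..k} L) $ i $ m"
    for i m
  proof (cases "i \<le> k")
    case i: True
    show ?thesis
    proof (cases "m \<le> k")
      case m: True
      \<comment> \<open>Padding changes \<open>B\<close> only outside the block, and there one of
        the two factors from \<open>L\<close> is zero.\<close>
      have *: "L $ i $ a * pad {..k} B $ a $ b * L $ m $ b = L $ i $ a * B $ a $ b * L $ m $ b" for a b
        using i m up[of i a] up[of m b] by (cases "a \<le> k"; cases "b \<le> k") (auto simp: pad_def)
      have "pad {..k} (congruence_map B L) $ i $ m = congruence_map B L $ i $ m"
        using i m by (simp add: pad_def)
      then show ?thesis
        using i m by (simp only: congruence_map_nth row sum_distrib_right *)
    next
      case m: False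
      then have "L $ i $ m = 0" using up i by auto
      moreover have "pad {..k} (congruence_map B L) $ i $ m = 0"
        using m i by (auto simp: pad_def)
      ultimately show ?thesis
        using i m by (simp add: congruence_map_nth row row' col' if_distrib[of "\<lambda>x. _ * x"] cong: if_cong)
    qed
  next
    case i: False
    have "pad {..k} (congruence_map B L) $ i $ m = (if m = i then 1 else 0)"
      using i row' by blast
    moreover have "pad {..k} L $ m $ i = (if m = i then 1 else 0)"
      using i col' by blast
    ultimately show ?thesis
      using i by (simp add: congruence_map_nth row' if_distrib[of "\<lambda>x. x * _"] cong: if_cong)
  qed
  then show ?thesis by (simp add: vec_eq_iff)
qed

text \<open>Padding commutes with the congruence and \<open>det\<close> is multiplicative. The
  square is what makes signs of minors invariant.\<close>

lemma leading_principal_minor_congruence_map: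
  assumes L: "L \<in> lower_triangular_matrices"
  shows "leading_principal_minor k (congruence_map B L)
    = (\<Prod>i\<in>{..k}. L $ i $ i)\<^sup>2 * leading_principal_minor k B"
proof -
  have "det (pad {..k} L) = (\<Prod>i\<in>{..k}. L $ i $ i)"
    using principal_minor_lower_triangular[OF L, of "{..k}"] by (simp add: principal_minor_eq_det_pad)
  then show ?thesis
    unfolding leading_principal_minor_def principal_minor_eq_det_pad pad_congruence_map[OF L]
    by (simp add: congruence_map_def det_mul power2_eq_square)
qed

definition diag :: "('n \<Rightarrow> real) \<Rightarrow> ('n :: finite) sqmat" where
  "diag d = (\<chi> i j. if i = j then d i else 0)"

lemma diag_lower_triangular: "diag d \<in> lower_triangular_matrices"
  by (auto simp: diag_def lower_triangular_matrices_def)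

lemma diag_symmetric: "diag d \<in> symmetric_matrices"
  by (simp add: diag_def symmetric_matrices_def transpose_def vec_eq_iff)

lemma leading_principal_minor_diag: "leading_principal_minor k (diag d) = (\<Prod>i\<in>{..k}. d i)"
  using principal_minor_lower_triangular[OF diag_lower_triangular, of "{..k}" d]
  by (simp add: leading_principal_minor_def diag_def)

lemma congruence_map_diag_nth:
  "congruence_map (diag d) L $ i $ m = (\<Sum>j\<in>UNIV. L $ i $ j * d j * L $ m $ j)"
  by (simp add: congruence_map_nth diag_def if_distrib[of "\<lambda>x. _ * x"] cong: if_cong)

lemma congruence_map_symmetric:
  "B \<in> symmetric_matrices \<Longrightarrow> congruence_map B L \<in> symmetric_matrices"
  by (simp add: symmetric_matrices_def congruence_map_def matrix_transpose_mul matrix_mul_assoc)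

lemma congruence_map_mult: "congruence_map B (L ** M) = congruence_map (congruence_map B M) L"
  by (simp add: congruence_map_def matrix_transpose_mul matrix_mul_assoc)


section \<open>Symmetric elimination\<close>

text \<open>
  If no pivot \<open>elim_entry A j j\<close> vanishes, \<open>elim_entry A i k\<close> is the entry \<open>(i, k)\<close> of \<open>L D\<close>, where
  \<open>A = L D L\<^sup>T\<close> with \<open>L\<close> unit lower triangular and \<open>D\<close> diagonal.
\<close>

function elim_entry :: "('n :: {finite, linorder}) sqmat \<Rightarrow> 'n \<Rightarrow> 'n \<Rightarrow> real" where
  "elim_entry A i k = (if i < k then 0 else
     A $ i $ k - (\<Sum>j\<in>{..<k}. elim_entry A i j * elim_entry A k j / elim_entry A j j))"
  by auto
text \<open>Every recursive call goes to an earlier column, so the number of columns before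
  \<open>k\<close> decreases.\<close>

termination
  by (relation "Wellfounded.measure (\<lambda>(A, i, k). card {..<k})")
    (simp_all only: wf_measure in_measure case_prod_conv lessThan_iff card_lessThan_mono)

declare elim_entry.simps [simp del]

abbreviation pivot :: "('n :: {finite, linorder}) sqmat \<Rightarrow> 'n \<Rightarrow> real" where
  "pivot A k \<equiv> elim_entry A k k"

text \<open>The diagonal is 1 outright rather than a quotient of pivots: a zero pivot would give
  \<open>0 / 0 = 0\<close>, and the matrix is to be unit lower triangular for every
  \<open>A\<close>.\<close>

definition ldl_factor :: "('n :: {finite, linorder}) sqmat \<Rightarrow> 'n sqmat" where
  "ldl_factor A = (\<chi> i j. if i = j then 1 else elim_entry A i j / pivot A j)"

lemma elim_entry_upper: "i < k \<Longrightarrow> elim_entry A i k = 0"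
  by (subst elim_entry.simps) simp

lemma ldl_factor_lower_triangular: "ldl_factor A \<in> lower_triangular_matrices"
  by (auto simp: ldl_factor_def lower_triangular_matrices_def elim_entry_upper)

text \<open>On and below the diagonal, the recursion for \<open>elim_entry\<close> is the equation
  \<open>A = L D L\<^sup>T\<close> solved for one entry of \<open>L D\<close>; symmetry gives the
  rest. Restricting to a leading block allows induction on the pivots.\<close>

lemma elimination_block:
  assumes sym: "A \<in> symmetric_matrices"
    and piv: "\<And>j. j < k \<Longrightarrow> pivot A j \<noteq> 0"
    and "i \<le> k" "m \<le> k"
  shows "congruence_map (diag (pivot A)) (ldl_factor A) $ i $ m = A $ i $ m"
proof -
  have *: "congruence_map (diag (pivot A)) (ldl_factor A) $ i $ m = A $ i $ m"
    if "m \<le> i" "i \<le> k" for i m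
  proof -
    let ?L = "ldl_factor A" and ?U = "elim_entry A"
    have "congruence_map (diag (pivot A)) ?L $ i $ m
        = (\<Sum>j\<in>insert m {..<m}. ?L $ i $ j * pivot A j * ?L $ m $ j)"
      unfolding congruence_map_diag_nth
      by (rule sum.mono_neutral_right) (auto simp: ldl_factor_def elim_entry_upper not_less)
    also have "\<dots> = ?L $ i $ m * pivot A m + (\<Sum>j\<in>{..<m}. ?U i j * ?U m j / ?U j j)"
    proof -
      have "?L $ i $ j * pivot A j * ?L $ m $ j = ?U i j * ?U m j / ?U j j" if "j < m" for j
        using that piv[of j] \<open>m \<le> i\<close> \<open>i \<le> k\<close> by (auto simp: ldl_factor_def)
      moreover have "?L $ m $ m = 1"
        by (simp add: ldl_factor_def)
      ultimately show ?thesis by simp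
    qed
    \<comment> \<open>If \<open>m < i\<close>, then \<open>m < k\<close> and the pivot is nonzero;
      if \<open>m = i\<close>, the left side is \<open>1 * pivot A m\<close>, whatever the
      pivot.\<close>
    also have "?L $ i $ m * pivot A m = ?U i m"
      using that piv[of m] by (auto simp: ldl_factor_def)
    finally show ?thesis
      using that by (simp add: elim_entry.simps[of A i m])
  qed
  have "M $ i $ m = M $ m $ i" if "M \<in> symmetric_matrices" for M :: "'a sqmat"
    using that by (auto simp: symmetric_matrices_def transpose_def vec_eq_iff)
  then show ?thesis
    using *[of m i] *[of i m] sym assms(3,4)
    by (metis congruence_map_symmetric diag_symmetric linear)
qed

text \<open>The minor sees only the block that the factorization reproduces, and congruence by a
  unit triangular matrix preserves it.\<close>

lemma leading_principal_minor_pivots: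
  assumes sym: "A \<in> symmetric_matrices" and piv: "\<And>j. j < k \<Longrightarrow> pivot A j \<noteq> 0"
  shows "leading_principal_minor k A = (\<Prod>j\<in>{..k}. pivot A j)"
proof -
  have "leading_principal_minor k A
      = leading_principal_minor k (congruence_map (diag (pivot A)) (ldl_factor A))"
    unfolding leading_principal_minor_def
    by (rule principal_minor_cong) (simp add: elimination_block[OF sym piv])
  then show ?thesis
    by (simp add: leading_principal_minor_congruence_map ldl_factor_lower_triangular
        leading_principal_minor_diag) (simp add: ldl_factor_def)
qed

text \<open>Once the earlier pivots are nonzero, the \<open>k\<close>-th pivot is a factor of the
  nonzero \<open>k\<close>-th minor.\<close>

lemma pivot_nonzero:
  assumes sym: "A \<in> symmetric_matrices" and nz: "\<And>k. leading_principal_minor k A \<noteq> 0"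
  shows "pivot A k \<noteq> 0"
proof (induction k rule: finite_less_induct)
  case (less k)
  have "(\<Prod>j\<in>{..k}. pivot A j) \<noteq> 0"
    using leading_principal_minor_pivots[OF sym less] nz[of k] by simp
  then show ?case by simp
qed

lemma elimination_factorization:
  assumes sym: "A \<in> symmetric_matrices" and nz: "\<And>k. leading_principal_minor k A \<noteq> 0"
  shows "congruence_map (diag (pivot A)) (ldl_factor A) = A"
proof -
  have "congruence_map (diag (pivot A)) (ldl_factor A) $ i $ m = A $ i $ m" for i m
    using nz by (intro elimination_block[OF sym, of "max i m"] pivot_nonzero[OF sym]) auto
  then show ?thesis by (simp add: vec_eq_iff)
qed

lemma LPM_D:
  assumes "A \<in> LPM \<epsilon>"
  shows "A \<in> symmetric_matrices" "leading_principal_minor k A \<noteq> 0"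
    "sgn (leading_principal_minor k A) = \<epsilon> k"
  using assms by (auto simp: LPM_def)

lemma LPM_pivot_nonzero: "A \<in> LPM \<epsilon> \<Longrightarrow> pivot A k \<noteq> 0"
  using pivot_nonzero LPM_D by blast

text \<open>Corresponding minors have equal signs, so their quotient is positive. It is the product
  of the pivot quotients up to \<open>k\<close>; the earlier ones are positive by induction, hence
  so is the last.\<close>

lemma LPM_pivot_quotient_pos:
  assumes A: "A \<in> LPM \<epsilon>" and B: "B \<in> LPM \<epsilon>"
  shows "pivot A k / pivot B k > 0"
proof (induction k rule: finite_less_induct)
  case (less k)
  have "(\<Prod>j\<in>{..k}. pivot A j / pivot B j) = leading_principal_minor k A / leading_principal_minor k B"
    using A B by (simp add: leading_principal_minor_pivots LPM_D LPM_pivot_nonzero prod_dividef)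
  also have "\<dots> > 0"
    using LPM_D(3)[OF A, of k] LPM_D(2,3)[OF B, of k]
    by (auto simp: zero_less_divide_iff sgn_if split: if_splits)
  also have "{..k} = insert k {..<k}"
    by auto
  finally have "(\<Prod>j\<in>insert k {..<k}. pivot A j / pivot B j) > 0" .
  moreover have "(\<Prod>j\<in>{..<k}. pivot A j / pivot B j) > 0"
    using less by (intro prod_pos) auto
  ultimately show ?case
    by (subst (asm) prod.insert) (simp_all only: finite lessThan_iff less_irrefl not_False_eq_True zero_less_mult_pos2)
qed


section \<open>The inverse of the congruence map\<close>

text \<open>Back substitution for \<open>X L = C\<close> with \<open>L\<close> unit lower
  triangular: within row \<open>i\<close>, each column follows from the later ones, without any
  division.\<close>

function right_solve :: "('n :: {finite, linorder}) sqmat \<Rightarrow> 'n sqmat \<Rightarrow> 'n \<Rightarrow> 'n \<Rightarrow> real" where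
  "right_solve C L i j = C $ i $ j - (\<Sum>k\<in>{j<..}. right_solve C L i k * L $ k $ j)"
  by auto
termination
  by (relation "Wellfounded.measure (\<lambda>(C, L, i, j). card {j<..})")
    (simp_all only: wf_measure in_measure case_prod_conv greaterThan_iff card_greaterThan_mono)

declare right_solve.simps [simp del]

lemma right_solve_mult:
  assumes L: "L \<in> lower_triangular_matrices" and unit: "\<And>i. L $ i $ i = 1"
  shows "(\<chi> i j. right_solve C L i j) ** L = C"
proof -
  have "(\<Sum>k\<in>UNIV. right_solve C L i k * L $ k $ j) = C $ i $ j" for i j
  proof -
    have "(\<Sum>k\<in>UNIV. right_solve C L i k * L $ k $ j)
        = (\<Sum>k\<in>insert j {j<..}. right_solve C L i k * L $ k $ j)"
      by (rule sum.mono_neutral_right) (use L in \<open>auto simp: lower_triangular_matrices_def\<close>)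
    then show ?thesis
      by (subst (asm) sum.insert) (auto simp: unit right_solve.simps[of C L i j])
  qed
  then show ?thesis
    by (simp add: matrix_matrix_mult_def vec_eq_iff)
qed

lemma right_solve_upper:
  assumes C: "C \<in> lower_triangular_matrices"
  shows "i < j \<Longrightarrow> right_solve C L i j = 0"
proof (induction j rule: finite_greater_induct)
  case (greater j)
  have "(\<Sum>k\<in>{j<..}. right_solve C L i k * L $ k $ j) = 0"
  proof (intro sum.neutral ballI)
    fix k assume "k \<in> {j<..}"
    then have "right_solve C L i k = 0"
      using greater.IH[of k] greater.prems less_trans[of i j k] by blast
    then show "right_solve C L i k * L $ k $ j = 0"
      by (simp only: mult_zero_left)
  qed
  moreover have "C $ i $ j = 0"
    using C greater.prems unfolding lower_triangular_matrices_def by blast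
  ultimately show ?case
    by (subst right_solve.simps) simp
qed

lemma right_solve_diagonal:
  assumes C: "C \<in> lower_triangular_matrices"
  shows "right_solve C L i i = C $ i $ i"
proof -
  have "(\<Sum>k\<in>{i<..}. right_solve C L i k * L $ k $ i) = 0"
    by (intro sum.neutral) (simp add: right_solve_upper[OF C])
  then show ?thesis
    by (subst right_solve.simps) simp
qed

text \<open>For \<open>A\<close> and \<open>B\<close> with the same pattern, this is the matrix
  \<open>C = L\<^sub>A (D\<^sub>A / D\<^sub>B)\<^sup>1\<^sup>/\<^sup>2\<close> with
  \<open>C D\<^sub>B C\<^sup>T = A\<close>. The wanted \<open>L\<close> then solves
  \<open>L L\<^sub>B = C\<close>.\<close>

definition scaled_factor :: "('n :: {finite, linorder}) sqmat \<Rightarrow> 'n sqmat \<Rightarrow> 'n sqmat" where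
  "scaled_factor A B = (\<chi> i j. ldl_factor A $ i $ j * sqrt (pivot A j / pivot B j))"

definition congruence_inverse :: "('n :: {finite, linorder}) sqmat \<Rightarrow> 'n sqmat \<Rightarrow> 'n sqmat" where
  "congruence_inverse B A = (\<chi> i j. right_solve (scaled_factor A B) (ldl_factor B) i j)"

lemma scaled_factor_lower_triangular: "scaled_factor A B \<in> lower_triangular_matrices"
  using ldl_factor_lower_triangular[of A]
  by (auto simp: scaled_factor_def lower_triangular_matrices_def)

lemma congruence_inverse_cholesky:
  assumes "A \<in> LPM \<epsilon>" "B \<in> LPM \<epsilon>"
  shows "congruence_inverse B A \<in> cholesky_space"
proof -
  have "scaled_factor A B $ i $ i > 0" for i
    using LPM_pivot_quotient_pos[OF assms, of i] by (simp add: scaled_factor_def ldl_factor_def)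
  then show ?thesis
    unfolding cholesky_space_def lower_triangular_matrices_def congruence_inverse_def
    by (simp add: right_solve_upper[OF scaled_factor_lower_triangular]
        right_solve_diagonal[OF scaled_factor_lower_triangular])
qed

lemma congruence_map_inverse:
  assumes A: "A \<in> LPM \<epsilon>" and B: "B \<in> LPM \<epsilon>"
  shows "congruence_map B (congruence_inverse B A) = A"
proof -
  have "congruence_map B (congruence_inverse B A)
      = congruence_map (congruence_map (diag (pivot B)) (ldl_factor B)) (congruence_inverse B A)"
    using B by (simp add: elimination_factorization LPM_D)
  \<comment> \<open>The two congruences compose to the one by
    \<open>congruence_inverse B A ** ldl_factor B\<close>, and back substitution makes this product
    \<open>scaled_factor A B\<close>.\<close>
  also have "\<dots> = congruence_map (diag (pivot B)) (scaled_factor A B)"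
    unfolding congruence_map_mult[symmetric] congruence_inverse_def
    by (subst right_solve_mult[OF ldl_factor_lower_triangular]) (auto simp: ldl_factor_def)
  also have "\<dots> = congruence_map (diag (pivot A)) (ldl_factor A)"
  proof -
    have "sqrt (pivot A j / pivot B j) * pivot B j * sqrt (pivot A j / pivot B j) = pivot A j" for j
    proof -
      have "sqrt (pivot A j / pivot B j) * sqrt (pivot A j / pivot B j) = pivot A j / pivot B j"
        using LPM_pivot_quotient_pos[OF A B, of j] by (intro real_sqrt_mult_self[THEN trans] abs_of_pos)
      then show ?thesis
        using LPM_pivot_nonzero[OF B, of j] by (simp add: mult.commute mult.left_commute)
    qed
    moreover have "scaled_factor A B $ i $ j * pivot B j * scaled_factor A B $ m $ j
        = ldl_factor A $ i $ j
          * (sqrt (pivot A j / pivot B j) * pivot B j * sqrt (pivot A j / pivot B j))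
          * ldl_factor A $ m $ j" for i j m
      unfolding scaled_factor_def vec_lambda_beta by (simp only: mult_ac)
    ultimately have "scaled_factor A B $ i $ j * pivot B j * scaled_factor A B $ m $ j
        = ldl_factor A $ i $ j * pivot A j * ldl_factor A $ m $ j" for i j m
      by simp
    then show ?thesis
      by (simp add: vec_eq_iff congruence_map_diag_nth)
  qed
  also have "\<dots> = A"
    using A by (simp add: elimination_factorization LPM_D)
  finally show ?thesis .
qed

section \<open>Injectivity of the congruence map\<close>

text \<open>Once the earlier columns agree, column \<open>k\<close> of the product determines
  \<open>C $ i $ k * d k * C $ k $ k\<close>. The entry \<open>i = k\<close> fixes the positive
  diagonal entry through its square; dividing by it then fixes the column.\<close>

lemma congruence_map_diag_inj:
  assumes C: "C \<in> cholesky_space" and C': "C' \<in> cholesky_space"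
    and d: "\<And>j. d j \<noteq> 0"
    and eq: "congruence_map (diag d) C = congruence_map (diag d) C'"
  shows "C = C'"
proof -
  have up: "C $ k $ j = 0" "C' $ k $ j = 0" if "k < j" for k j
    using C C' that by (auto simp: cholesky_space_def lower_triangular_matrices_def)
  have "\<forall>i. C $ i $ k = C' $ i $ k" for k
  proof (induction k rule: finite_less_induct)
    case (less k)
    have split: "(\<Sum>j\<in>UNIV. M $ i $ j * d j * M $ k $ j)
        = M $ i $ k * d k * M $ k $ k + (\<Sum>j\<in>{..<k}. M $ i $ j * d j * M $ k $ j)"
      if "\<And>j. k < j \<Longrightarrow> M $ k $ j = 0" for i and M :: "'a sqmat"
    proof -
      have "(\<Sum>j\<in>UNIV. M $ i $ j * d j * M $ k $ j)
          = (\<Sum>j\<in>insert k {..<k}. M $ i $ j * d j * M $ k $ j)"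
        by (rule sum.mono_neutral_right) (use that in \<open>auto simp: not_less\<close>)
      then show ?thesis by (subst (asm) sum.insert) auto
    qed
    have *: "C $ i $ k * C $ k $ k = C' $ i $ k * C' $ k $ k" for i
    proof -
      have "congruence_map (diag d) C $ i $ k = congruence_map (diag d) C' $ i $ k"
        using eq by simp
      then have "C $ i $ k * d k * C $ k $ k = C' $ i $ k * d k * C' $ k $ k"
        using less by (simp add: congruence_map_diag_nth split up)
      then show ?thesis
        using d[of k] by simp
    qed
    have pos: "C $ k $ k > 0" "C' $ k $ k > 0"
      using C C' by (auto simp: cholesky_space_def)
    then have "C $ k $ k = C' $ k $ k"
      using *[of k] by (simp add: power2_eq_square[symmetric] power2_eq_iff_nonneg)
    then show ?case
      using * pos by simp
  qed
  then show ?thesis by (simp add: vec_eq_iff)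
qed

lemma cholesky_space_mult:
  assumes L: "L \<in> cholesky_space" and M: "M \<in> cholesky_space"
  shows "L ** M \<in> cholesky_space"
proof -
  have up: "L $ i $ j = 0" "M $ i $ j = 0" if "i < j" for i j
    using L M that by (auto simp: cholesky_space_def lower_triangular_matrices_def)
  have "(\<Sum>k\<in>UNIV. L $ i $ k * M $ k $ j) = 0" if "i < j" for i j
  proof (rule sum.neutral, intro ballI)
    fix k
    show "L $ i $ k * M $ k $ j = 0"
    proof (cases "i < k")
      case False
      then have "k < j" using that by simp
      then show ?thesis by (simp only: up mult_zero_right)
    qed (simp only: up mult_zero_left)
  qed
  moreover have "(\<Sum>k\<in>UNIV. L $ i $ k * M $ k $ i) > 0" for i
  proof -
    have "L $ i $ k * M $ k $ i = 0" if "k \<noteq> i" for k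
    proof (cases "i < k")
      case False
      then have "k < i" using that by simp
      then show ?thesis by (simp only: up mult_zero_right)
    qed (simp only: up mult_zero_left)
    then have "(\<Sum>k\<in>UNIV. L $ i $ k * M $ k $ i) = (\<Sum>k\<in>{i}. L $ i $ k * M $ k $ i)"
      by (intro sum.mono_neutral_right) auto
    then show ?thesis
      using L M by (simp add: cholesky_space_def)
  qed
  ultimately show ?thesis
    by (simp add: cholesky_space_def lower_triangular_matrices_def matrix_matrix_mult_def)
qed

lemma ldl_factor_cholesky: "ldl_factor A \<in> cholesky_space"
  using ldl_factor_lower_triangular[of A] by (auto simp: cholesky_space_def ldl_factor_def)

lemma det_ldl_factor: "det (ldl_factor A) = 1"
  using principal_minor_lower_triangular[OF ldl_factor_lower_triangular, of UNIV A]
  by (simp add: principal_minor_UNIV) (simp add: ldl_factor_def)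

text \<open>Replacing \<open>L\<close> by \<open>L ** ldl_factor B\<close> reduces \<open>B\<close>
  to the diagonal matrix of its pivots; the factor has determinant 1 and cancels.\<close>

lemma congruence_map_inj_on:
  assumes B: "B \<in> LPM \<epsilon>"
  shows "inj_on (congruence_map B) cholesky_space"
proof (rule inj_onI)
  fix L M :: "'a sqmat"
  assume L: "L \<in> cholesky_space" and M: "M \<in> cholesky_space"
    and eq: "congruence_map B L = congruence_map B M"
  have "congruence_map (diag (pivot B)) (X ** ldl_factor B) = congruence_map B X" for X
    by (simp only: congruence_map_mult elimination_factorization[OF LPM_D(1,2)[OF B]])
  then have "congruence_map (diag (pivot B)) (L ** ldl_factor B)
      = congruence_map (diag (pivot B)) (M ** ldl_factor B)"
    by (simp only: eq)
  then have eq': "L ** ldl_factor B = M ** ldl_factor B"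
    by (rule congruence_map_diag_inj[rotated 3])
      (intro L M cholesky_space_mult ldl_factor_cholesky LPM_pivot_nonzero[OF B])+
  obtain N where N: "ldl_factor B ** N = mat 1"
    using invertible_det_nz[of "ldl_factor B"] unfolding det_ldl_factor invertible_def by auto
  have "L ** (ldl_factor B ** N) = M ** (ldl_factor B ** N)"
    by (simp only: matrix_mul_assoc eq')
  then show "L = M"
    by (simp add: N)
qed

text \<open>Each leading minor of \<open>B\<close> is multiplied by the square of a positive
  number.\<close>

lemma congruence_map_LPM:
  assumes B: "B \<in> LPM \<epsilon>" and L: "L \<in> cholesky_space"
  shows "congruence_map B L \<in> LPM \<epsilon>"
proof -
  have "leading_principal_minor k (congruence_map B L) \<noteq> 0
      \<and> sgn (leading_principal_minor k (congruence_map B L)) = \<epsilon> k" for k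
  proof -
    have "(\<Prod>i\<in>{..k}. L $ i $ i) > 0"
      using L by (intro prod_pos) (auto simp: cholesky_space_def)
    then have "sgn ((\<Prod>i\<in>{..k}. L $ i $ i)\<^sup>2) = 1"
      by simp
    moreover have "L \<in> lower_triangular_matrices"
      using L by (simp add: cholesky_space_def)
    ultimately show ?thesis
      using LPM_D(2,3)[OF B, of k] \<open>0 < _\<close>
      by (simp only: leading_principal_minor_congruence_map sgn_mult mult_1 mult_eq_0_iff
          zero_eq_power2 less_imp_neq[symmetric] simp_thms)
  qed
  then show ?thesis
    using congruence_map_symmetric[OF LPM_D(1)[OF B]] by (simp only: LPM_def mem_Collect_eq simp_thms)
qed

lemma bij_betw_congruence_map:
  assumes "B \<in> LPM \<epsilon>"
  shows "bij_betw (congruence_map B) cholesky_space (LPM \<epsilon>)"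
proof (intro bij_betw_imageI congruence_map_inj_on[OF assms] equalityI subsetI)
  fix A assume "A \<in> LPM \<epsilon>"
  then show "A \<in> congruence_map B ` cholesky_space"
    using congruence_inverse_cholesky[OF _ assms] congruence_map_inverse[OF _ assms]
    by (metis image_eqI)
qed (use congruence_map_LPM[OF assms] in auto)

lemma inv_into_congruence_map:
  assumes "A \<in> LPM \<epsilon>" "B \<in> LPM \<epsilon>"
  shows "inv_into cholesky_space (congruence_map B) A = congruence_inverse B A"
  using assms
  by (intro inv_into_f_eq congruence_map_inj_on congruence_inverse_cholesky congruence_map_inverse)


section \<open>Arithmetic functions of two matrices\<close>

text \<open>Each rule corresponds both to an instruction and to a rule of calculus. Divisors and
  radicands must be admissible on all of \<open>D\<close>, because a program has no branches and
  must not fail on any input from \<open>D\<close>.\<close>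

inductive_set arith_funs ::
  "(('n :: finite) sqmat \<times> 'n sqmat) set \<Rightarrow> ('n sqmat \<times> 'n sqmat \<Rightarrow> real) set"
  for D :: "('n sqmat \<times> 'n sqmat) set" where
  entry_A: "(\<lambda>z. fst z $ i $ j) \<in> arith_funs D"
| entry_B: "(\<lambda>z. snd z $ i $ j) \<in> arith_funs D"
| zero: "(\<lambda>z. 0) \<in> arith_funs D"
| one: "(\<lambda>z. 1) \<in> arith_funs D"
| add: "f \<in> arith_funs D \<Longrightarrow> g \<in> arith_funs D \<Longrightarrow> (\<lambda>z. f z + g z) \<in> arith_funs D"
| diff: "f \<in> arith_funs D \<Longrightarrow> g \<in> arith_funs D \<Longrightarrow> (\<lambda>z. f z - g z) \<in> arith_funs D"
| mult: "f \<in> arith_funs D \<Longrightarrow> g \<in> arith_funs D \<Longrightarrow> (\<lambda>z. f z * g z) \<in> arith_funs D"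
| divide: "f \<in> arith_funs D \<Longrightarrow> g \<in> arith_funs D \<Longrightarrow> (\<And>z. z \<in> D \<Longrightarrow> g z \<noteq> 0)
    \<Longrightarrow> (\<lambda>z. f z / g z) \<in> arith_funs D"
| sqrt: "f \<in> arith_funs D \<Longrightarrow> (\<And>z. z \<in> D \<Longrightarrow> f z > 0) \<Longrightarrow> (\<lambda>z. sqrt (f z)) \<in> arith_funs D"

lemma arith_funs_sum:
  assumes "finite I" "\<And>i. i \<in> I \<Longrightarrow> f i \<in> arith_funs D"
  shows "(\<lambda>z. \<Sum>i\<in>I. f i z) \<in> arith_funs D"
  using assms by (induction I rule: finite_induct) (simp_all add: arith_funs.zero arith_funs.add)

text \<open>\<open>p\<close> stands for either projection, so that one statement serves both
  matrices. The induction on the column keeps the row general, since the recursion also visits other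
  rows.\<close>

lemma arith_funs_elim_entry:
  assumes entry: "\<And>i j. (\<lambda>z. p z $ i $ j) \<in> arith_funs D"
    and nz: "\<And>z k. z \<in> D \<Longrightarrow> pivot (p z) k \<noteq> 0"
  shows "(\<lambda>z. elim_entry (p z) i k) \<in> arith_funs D"
proof (induction k arbitrary: i rule: finite_less_induct)
  case (less k)
  show ?case
  proof (cases "i < k")
    case True
    then show ?thesis by (simp add: elim_entry_upper arith_funs.zero)
  next
    case False
    have "(\<lambda>z. p z $ i $ k -
        (\<Sum>j\<in>{..<k}. elim_entry (p z) i j * elim_entry (p z) k j / elim_entry (p z) j j)) \<in> arith_funs D"
      by (intro arith_funs.diff arith_funs_sum arith_funs.divide arith_funs.mult less entry nz) auto
    then show ?thesis
      by (subst elim_entry.simps) (simp only: False if_False)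
  qed
qed

lemma arith_funs_ldl_factor:
  assumes "\<And>i j. (\<lambda>z. p z $ i $ j) \<in> arith_funs D" "\<And>z k. z \<in> D \<Longrightarrow> pivot (p z) k \<noteq> 0"
  shows "(\<lambda>z. ldl_factor (p z) $ i $ j) \<in> arith_funs D"
  using arith_funs_elim_entry[where p = p, OF assms] assms(2)
  by (cases "i = j") (simp_all add: ldl_factor_def arith_funs.one arith_funs.divide)

lemma arith_funs_right_solve:
  assumes C: "\<And>i j. (\<lambda>z. C z $ i $ j) \<in> arith_funs D"
    and L: "\<And>i j. (\<lambda>z. L z $ i $ j) \<in> arith_funs D"
  shows "(\<lambda>z. right_solve (C z) (L z) i j) \<in> arith_funs D"
proof (induction j rule: finite_greater_induct)
  case (greater j)
  have "(\<lambda>z. C z $ i $ j - (\<Sum>k\<in>{j<..}. right_solve (C z) (L z) i k * L z $ k $ j)) \<in> arith_funs D"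
    by (intro arith_funs.diff arith_funs_sum arith_funs.mult greater C L) auto
  then show ?case
    by (subst right_solve.simps)
qed

text \<open>Taking the union over all patterns yields a single program for all of them. If some
  value of \<open>\<epsilon>\<close> is not 1 or -1, then \<open>LPM \<epsilon>\<close> is empty and
  adds nothing.\<close>

definition same_pattern_pairs :: "(('n :: {finite, linorder}) sqmat \<times> 'n sqmat) set" where
  "same_pattern_pairs = (\<Union>\<epsilon>. LPM \<epsilon> \<times> LPM \<epsilon>)"

lemma arith_funs_congruence_inverse:
  "(\<lambda>z. congruence_inverse (snd z) (fst z) $ i $ j) \<in> arith_funs same_pattern_pairs"
proof -
  have fst: "pivot (fst z) k \<noteq> 0" and snd: "pivot (snd z) k \<noteq> 0"
    and pos: "pivot (fst z) k / pivot (snd z) k > 0"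
    if "z \<in> same_pattern_pairs" for z :: "'a sqmat \<times> 'a sqmat" and k
    using that by (auto simp only: same_pattern_pairs_def mem_Times_iff UN_iff
        dest: LPM_pivot_nonzero LPM_pivot_quotient_pos)
  have "(\<lambda>z. scaled_factor (fst z) (snd z) $ i $ j) \<in> arith_funs same_pattern_pairs" for i j :: 'a
    unfolding scaled_factor_def vec_lambda_beta
    by (intro arith_funs.mult arith_funs.sqrt arith_funs.divide arith_funs_ldl_factor
        arith_funs_elim_entry arith_funs.entry_A arith_funs.entry_B fst snd pos)
  moreover have "(\<lambda>z. ldl_factor (snd z) $ i $ j) \<in> arith_funs same_pattern_pairs" for i j :: 'a
    by (intro arith_funs_ldl_factor arith_funs.entry_B snd)
  ultimately show ?thesis
    unfolding congruence_inverse_def vec_lambda_beta by (rule arith_funs_right_solve)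
qed


section \<open>Programs for arithmetic functions\<close>

lemma run_program_append:
  "run_program A B (P @ Q) mem = Option.bind (run_program A B P mem) (run_program A B Q)"
  by (induction P arbitrary: mem) (auto split: option.splits)

text \<open>
  Instructions refer to absolute positions. Asking for a program for every size of the initial memory
  lets programs be concatenated without relocation.
\<close>

definition programmable ::
  "(('n :: finite) sqmat \<times> 'n sqmat) set \<Rightarrow> ('n sqmat \<times> 'n sqmat \<Rightarrow> real) \<Rightarrow> bool" where
  "programmable D f \<longleftrightarrow> (\<forall>m. \<exists>P a. \<forall>z\<in>D. \<forall>mem. length mem = m \<longrightarrow>
     (\<exists>mem'. run_program (fst z) (snd z) P mem = Some (mem @ mem') \<and>
             length (mem @ mem') = Suc a \<and> (mem @ mem') ! a = f z))"

lemma programmable_nullary: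
  assumes "\<And>z mem. z \<in> D \<Longrightarrow> exec_instr (fst z) (snd z) mem c = Some (h z)"
  shows "programmable D h"
  unfolding programmable_def
proof
  fix m
  show "\<exists>P a. \<forall>z\<in>D. \<forall>mem. length mem = m \<longrightarrow>
     (\<exists>mem'. run_program (fst z) (snd z) P mem = Some (mem @ mem') \<and>
             length (mem @ mem') = Suc a \<and> (mem @ mem') ! a = h z)"
    by (rule exI[of _ "[c]"], rule exI[of _ m]) (auto simp: assms)
qed

text \<open>Memory only grows, so the first result stays at its position while the second program
  runs. The final length does not depend on the input, hence the second program can be chosen for
  exactly that initial size.\<close>

lemma programmable_binary:
  assumes f: "programmable D f" and g: "programmable D g"
    and exec: "\<And>z mem a b. z \<in> D \<Longrightarrow> a < length mem \<Longrightarrow> b < length mem \<Longrightarrow>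
      mem ! a = f z \<Longrightarrow> mem ! b = g z \<Longrightarrow> exec_instr (fst z) (snd z) mem (c a b) = Some (h z)"
  shows "programmable D h"
  unfolding programmable_def
proof
  fix m
  obtain P a where P: "\<And>z mem. z \<in> D \<Longrightarrow> length mem = m \<Longrightarrow>
      \<exists>mem'. run_program (fst z) (snd z) P mem = Some (mem @ mem') \<and>
             length (mem @ mem') = Suc a \<and> (mem @ mem') ! a = f z"
    using f unfolding programmable_def by meson
  obtain Q b where Q: "\<And>z mem. z \<in> D \<Longrightarrow> length mem = Suc a \<Longrightarrow>
      \<exists>mem'. run_program (fst z) (snd z) Q mem = Some (mem @ mem') \<and>
             length (mem @ mem') = Suc b \<and> (mem @ mem') ! b = g z"
    using g unfolding programmable_def by meson
  show "\<exists>P a. \<forall>z\<in>D. \<forall>mem. length mem = m \<longrightarrow>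
     (\<exists>mem'. run_program (fst z) (snd z) P mem = Some (mem @ mem') \<and>
             length (mem @ mem') = Suc a \<and> (mem @ mem') ! a = h z)"
  proof (intro exI[of _ "P @ Q @ [c a b]"] exI[of _ "Suc b"] ballI allI impI)
    fix z mem assume z: "z \<in> D" and "length (mem :: real list) = m"
    then obtain mem1 where 1: "run_program (fst z) (snd z) P mem = Some (mem @ mem1)"
      "length (mem @ mem1) = Suc a" "(mem @ mem1) ! a = f z"
      using P by blast
    obtain mem2 where 2: "run_program (fst z) (snd z) Q (mem @ mem1) = Some ((mem @ mem1) @ mem2)"
      "length ((mem @ mem1) @ mem2) = Suc b" "((mem @ mem1) @ mem2) ! b = g z"
      using Q[OF z 1(2)] by blast
    have "((mem @ mem1) @ mem2) ! a = f z"
      using 1 by (simp only: nth_append[of "mem @ mem1"] if_True lessI)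
    moreover have "a < length ((mem @ mem1) @ mem2)"
      using 1(2) by simp
    ultimately have "exec_instr (fst z) (snd z) ((mem @ mem1) @ mem2) (c a b) = Some (h z)"
      using 2 by (intro exec[OF z]) simp_all
    then have "run_program (fst z) (snd z) (P @ Q @ [c a b]) mem = Some (mem @ mem1 @ mem2 @ [h z])"
      using 1 2 by (simp add: run_program_append)
    moreover have "length (mem @ mem1 @ mem2 @ [h z]) = Suc (Suc b)"
      using 2(2) by simp
    moreover have "(mem @ mem1 @ mem2 @ [h z]) ! Suc b = h z"
      using 2(2) nth_append_length[of "mem @ mem1 @ mem2" "h z"] by simp
    ultimately show "\<exists>mem'. run_program (fst z) (snd z) (P @ Q @ [c a b]) mem = Some (mem @ mem') \<and>
        length (mem @ mem') = Suc (Suc b) \<and> (mem @ mem') ! Suc b = h z"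
      by blast
  qed
qed

lemma arith_funs_programmable: "f \<in> arith_funs D \<Longrightarrow> programmable D f"
proof (induction rule: arith_funs.induct)
  case (entry_A i j)
  show ?case by (rule programmable_nullary[of _ "Entry_A i j"]) simp
next
  case (entry_B i j)
  show ?case by (rule programmable_nullary[of _ "Entry_B i j"]) simp
next
  case zero
  show ?case by (rule programmable_nullary[of _ "Zero"]) simp
next
  case one
  show ?case by (rule programmable_nullary[of _ "One"]) simp
next
  case (add f g)
  show ?case by (rule programmable_binary[OF add.IH, where c = Add]) simp
next
  case (diff f g)
  show ?case by (rule programmable_binary[OF diff.IH, where c = Sub]) simp
next
  case (mult f g)
  show ?case by (rule programmable_binary[OF mult.IH, where c = Mul]) simp
next
  case (divide f g)
  show ?case by (rule programmable_binary[OF divide.IH, where c = Div]) (simp add: divide.hyps)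
next
  case (sqrt f)
  \<comment> \<open>The unary instruction is fitted into the binary scheme by computing
    \<open>f\<close> twice and reading the first copy.\<close>
  show ?case by (rule programmable_binary[OF sqrt.IH sqrt.IH, where c = "\<lambda>a b. Sqrt a"]) (simp add: sqrt.hyps)
qed

text \<open>The programs run one after another. The common length \<open>n\<close> makes the output
  positions the same for all inputs.\<close>

lemma programmable_family:
  assumes "finite I" and "\<And>i. i \<in> I \<Longrightarrow> programmable D (f i)"
  shows "\<exists>P out n. \<forall>z\<in>D. \<exists>mem. run_program (fst z) (snd z) P [] = Some mem \<and> length mem = n \<and>
    (\<forall>i\<in>I. out i < n \<and> mem ! out i = f i z)"
  using assms
proof (induction I rule: finite_induct)
  case empty
  show ?case by (rule exI[of _ "[]"]) auto
next
  case (insert i I)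
  then obtain P out n where P: "\<And>z. z \<in> D \<Longrightarrow> \<exists>mem. run_program (fst z) (snd z) P [] = Some mem \<and>
      length mem = n \<and> (\<forall>i\<in>I. out i < n \<and> mem ! out i = f i z)"
    by (metis insertCI)
  obtain Q a where Q: "\<And>z mem. z \<in> D \<Longrightarrow> length mem = n \<Longrightarrow>
      \<exists>mem'. run_program (fst z) (snd z) Q mem = Some (mem @ mem') \<and>
             length (mem @ mem') = Suc a \<and> (mem @ mem') ! a = f i z"
    using insert.prems[of i] unfolding programmable_def by (meson insertI1)
  show ?case
  proof (intro exI[of _ "P @ Q"] exI[of _ "out(i := a)"] exI[of _ "Suc a"] ballI)
    fix z assume z: "z \<in> D"
    obtain mem where 1: "run_program (fst z) (snd z) P [] = Some mem" "length mem = n"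
      "\<And>i. i \<in> I \<Longrightarrow> out i < n \<and> mem ! out i = f i z"
      using P[OF z] by blast
    obtain mem' where 2: "run_program (fst z) (snd z) Q mem = Some (mem @ mem')"
      "length (mem @ mem') = Suc a" "(mem @ mem') ! a = f i z"
      using Q[OF z 1(2)] by blast
    have "out k < Suc a \<and> (mem @ mem') ! out k = f k z" if "k \<in> I" for k
      using 1(2) 1(3)[OF that] 2(2) by (simp add: nth_append)
    then show "\<exists>mem. run_program (fst z) (snd z) (P @ Q) [] = Some mem \<and> length mem = Suc a \<and>
        (\<forall>k\<in>insert i I. (out(i := a)) k < Suc a \<and> mem ! (out(i := a)) k = f k z)"
      using 1(1) 2 insert.hyps by (intro exI[of _ "mem @ mem'"]) (auto simp: run_program_append)
  qed
qed

lemma congruence_inverse_program: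
  "\<exists>(P :: ('n :: {finite, linorder}) instr list) out. \<forall>\<epsilon>. \<forall>B \<in> LPM \<epsilon>. \<forall>A \<in> LPM \<epsilon>.
     program_computes P out A B (congruence_inverse B A)"
proof -
  have "\<exists>(P :: 'n instr list) out n. \<forall>z\<in>same_pattern_pairs. \<exists>mem. run_program (fst z) (snd z) P [] = Some mem \<and>
      length mem = n \<and> (\<forall>ij\<in>UNIV. out ij < n \<and>
        mem ! out ij = congruence_inverse (snd z) (fst z) $ fst ij $ snd ij)"
    by (intro programmable_family finite arith_funs_programmable arith_funs_congruence_inverse)
  then obtain P :: "'n instr list" and out :: "'n \<times> 'n \<Rightarrow> nat" and n
    where P: "\<And>z. z \<in> same_pattern_pairs \<Longrightarrow> \<exists>mem. run_program (fst z) (snd z) P [] = Some mem \<and>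
      length mem = n \<and> (\<forall>ij\<in>UNIV. out ij < n \<and>
        mem ! out ij = congruence_inverse (snd z) (fst z) $ fst ij $ snd ij)"
    by blast
  have "program_computes P (\<lambda>i j. out (i, j)) A B (congruence_inverse B A)"
    if "A \<in> LPM \<epsilon>" "B \<in> LPM \<epsilon>" for A B \<epsilon>
  proof -
    have "(A, B) \<in> same_pattern_pairs"
      using that unfolding same_pattern_pairs_def by blast
    from P[OF this] show ?thesis
      unfolding program_computes_def by fastforce
  qed
  then show ?thesis by blast
qed


section \<open>Smoothness\<close>

lemma Ck_on_const: "Ck_on k V U (\<lambda>x. c)"
  by (induction k arbitrary: c) (auto intro!: exI[of _ "\<lambda>x v. 0"])

lemma Ck_on_linear: "bounded_linear f \<Longrightarrow> Ck_on k V U f"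
  by (cases k) (auto intro!: exI[of _ "\<lambda>x. f"] bounded_linear_imp_has_derivative Ck_on_const
      linear_continuous_on)

lemma Ck_on_compose_linear:
  "bounded_linear h \<Longrightarrow> Ck_on k V U f \<Longrightarrow> Ck_on k V U (\<lambda>x. h (f x))"
proof (induction k arbitrary: f)
  case 0
  then show ?case
    using continuous_on_compose2[OF linear_continuous_on[of h UNIV]] by auto
next
  case (Suc k)
  obtain f' where f: "\<forall>x\<in>U. (f has_derivative f' x) (at x within U)" "\<forall>v\<in>V. Ck_on k V U (\<lambda>x. f' x v)"
    using Suc.prems(2) by auto
  have "\<forall>x\<in>U. ((\<lambda>x. h (f x)) has_derivative (\<lambda>v. h (f' x v))) (at x within U)"
    using f(1) bounded_linear.has_derivative[OF Suc.prems(1)] by blast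
  moreover have "\<forall>v\<in>V. Ck_on k V U (\<lambda>x. h (f' x v))"
    using f(2) Suc.IH[OF Suc.prems(1)] by blast
  ultimately show ?case
    unfolding Ck_on.simps by (intro exI[of _ "\<lambda>x v. h (f' x v)"] conjI)
qed

lemma Ck_on_add:
  "Ck_on k V U f \<Longrightarrow> Ck_on k V U g \<Longrightarrow> Ck_on k V U (\<lambda>x. f x + g x)"
proof (induction k arbitrary: f g)
  case 0
  then show ?case by (auto intro: continuous_on_add)
next
  case (Suc k)
  obtain f' where f: "\<forall>x\<in>U. (f has_derivative f' x) (at x within U)" "\<forall>v\<in>V. Ck_on k V U (\<lambda>x. f' x v)"
    using Suc.prems(1) by auto
  obtain g' where g: "\<forall>x\<in>U. (g has_derivative g' x) (at x within U)" "\<forall>v\<in>V. Ck_on k V U (\<lambda>x. g' x v)"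
    using Suc.prems(2) by auto
  show ?case
    using f g Suc.IH by (auto intro!: exI[of _ "\<lambda>x v. f' x v + g' x v"] has_derivative_add)
qed

lemma Ck_on_minus: "Ck_on k V U f \<Longrightarrow> Ck_on k V U (\<lambda>x. - f x)"
  by (rule Ck_on_compose_linear[of uminus]) (rule bounded_linear_minus[OF bounded_linear_ident])

lemma Ck_on_diff: "Ck_on k V U f \<Longrightarrow> Ck_on k V U g \<Longrightarrow> Ck_on k V U (\<lambda>x. f x - g x)"
  by (drule Ck_on_minus[of k V U g]) (drule (1) Ck_on_add, simp)

lemma Ck_on_sum:
  assumes "finite I" "\<And>i. i \<in> I \<Longrightarrow> Ck_on k V U (f i)"
  shows "Ck_on k V U (\<lambda>x. \<Sum>i\<in>I. f i x)"
  using assms by (induction I rule: finite_induct) (simp_all add: Ck_on_const Ck_on_add)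

text \<open>Derivatives of products, reciprocals and roots contain the functions themselves, which
  must therefore be available one order lower.\<close>

lemma Ck_on_SucD: "Ck_on (Suc k) V U f \<Longrightarrow> Ck_on k V U f"
proof (induction k arbitrary: f)
  case 0
  then show ?case
    by (auto simp: continuous_on_eq_continuous_within intro: has_derivative_continuous)
next
  case (Suc k)
  then show ?case by (metis Ck_on.simps(2))
qed

lemma Ck_on_mult:
  fixes f g :: "'a :: euclidean_space \<Rightarrow> real"
  shows "Ck_on k V U f \<Longrightarrow> Ck_on k V U g \<Longrightarrow> Ck_on k V U (\<lambda>x. f x * g x)"
proof (induction k arbitrary: f g)
  case 0
  then show ?case by (auto intro: continuous_on_mult)
next
  case (Suc k)
  obtain f' where f: "\<forall>x\<in>U. (f has_derivative f' x) (at x within U)" "\<forall>v\<in>V. Ck_on k V U (\<lambda>x. f' x v)"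
    using Suc.prems(1) by auto
  obtain g' where g: "\<forall>x\<in>U. (g has_derivative g' x) (at x within U)" "\<forall>v\<in>V. Ck_on k V U (\<lambda>x. g' x v)"
    using Suc.prems(2) by auto
  have "Ck_on k V U f" "Ck_on k V U g"
    by (rule Ck_on_SucD[OF Suc.prems(1)], rule Ck_on_SucD[OF Suc.prems(2)])
  then show ?case
    using f g Suc.IH
    by (auto intro!: exI[of _ "\<lambda>x v. f x * g' x v + f' x v * g x"] has_derivative_mult Ck_on_add)
qed

text \<open>The derivative is \<open>- f' / f\<^sup>2\<close>, in which the reciprocal recurs; it is
  covered by the induction hypothesis.\<close>

lemma Ck_on_inverse:
  fixes f :: "'a :: euclidean_space \<Rightarrow> real"
  assumes nz: "\<And>x. x \<in> U \<Longrightarrow> f x \<noteq> 0"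
  shows "Ck_on k V U f \<Longrightarrow> Ck_on k V U (\<lambda>x. inverse (f x))"
proof (induction k)
  case 0
  then show ?case using nz by (auto intro: continuous_on_inverse)
next
  case (Suc k)
  obtain f' where f: "\<forall>x\<in>U. (f has_derivative f' x) (at x within U)" "\<forall>v\<in>V. Ck_on k V U (\<lambda>x. f' x v)"
    using Suc.prems by auto
  have "Ck_on k V U (\<lambda>x. inverse (f x))"
    using Suc Ck_on_SucD by blast
  then show ?case
    using f nz
    by (auto intro!: exI[of _ "\<lambda>x v. - (inverse (f x) * f' x v * inverse (f x))"]
        has_derivative_inverse Ck_on_minus Ck_on_mult)
qed

lemma Ck_on_sqrt:
  fixes f :: "'a :: euclidean_space \<Rightarrow> real"
  assumes pos: "\<And>x. x \<in> U \<Longrightarrow> f x > 0"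
  shows "Ck_on k V U f \<Longrightarrow> Ck_on k V U (\<lambda>x. sqrt (f x))"
proof (induction k)
  case 0
  then show ?case by (auto intro: continuous_on_real_sqrt)
next
  case (Suc k)
  obtain f' where f: "\<forall>x\<in>U. (f has_derivative f' x) (at x within U)" "\<forall>v\<in>V. Ck_on k V U (\<lambda>x. f' x v)"
    using Suc.prems by auto
  have "Ck_on k V U (\<lambda>x. sqrt (f x))"
    using Suc Ck_on_SucD by blast
  then have "Ck_on k V U (\<lambda>x. inverse (sqrt (f x)))"
    using pos by (intro Ck_on_inverse) (auto simp: less_imp_neq[symmetric])
  then have "Ck_on k V U (\<lambda>x. f' x v * (inverse (sqrt (f x)) * (1 / 2)))" if "v \<in> V" for v
    using f that by (intro Ck_on_mult Ck_on_const) auto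
  then show ?case
    using f pos
    by (auto intro!: exI[of _ "\<lambda>x v. f' x v * (inverse (sqrt (f x)) / 2)"] has_derivative_real_sqrt)
qed

lemma Ck_on_divide:
  fixes f g :: "'a :: euclidean_space \<Rightarrow> real"
  assumes "Ck_on k V U f" "Ck_on k V U g" "\<And>x. x \<in> U \<Longrightarrow> g x \<noteq> 0"
  shows "Ck_on k V U (\<lambda>x. f x / g x)"
  unfolding divide_inverse using assms by (intro Ck_on_mult Ck_on_inverse)

text \<open>Derivatives within \<open>U\<close> see only values on \<open>U\<close>, so the same
  \<open>f'\<close> serves both functions and a case distinction on \<open>k\<close>
  suffices.\<close>

lemma Ck_on_cong:
  assumes eq: "\<And>x. x \<in> U \<Longrightarrow> f x = g x"
  shows "Ck_on k V U f \<longleftrightarrow> Ck_on k V U g"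
proof (cases k)
  case 0
  then show ?thesis using eq by (simp cong: continuous_on_cong)
next
  case (Suc j)
  have "(f has_derivative D) (at x within U) \<longleftrightarrow> (g has_derivative D) (at x within U)" if "x \<in> U" for x D
    using has_derivative_transform[OF that, of f g] has_derivative_transform[OF that, of g f] eq by auto
  then show ?thesis using Suc by simp
qed

text \<open>A matrix is the sum of its entries times the constant matrix units.\<close>

lemma Ck_on_matrix:
  fixes f :: "'a :: euclidean_space \<Rightarrow> ('n :: finite) sqmat"
  assumes "\<And>i j. Ck_on k V U (\<lambda>x. f x $ i $ j)"
  shows "Ck_on k V U f"
proof -
  have "(\<Sum>i\<in>UNIV. \<Sum>j\<in>UNIV. M $ i $ j *\<^sub>R axis i (axis j 1)) = M" for M :: "'n sqmat"
  proof -
    have "(\<Sum>j\<in>UNIV. M $ i $ j *\<^sub>R axis i (axis j 1) $ l $ m) = (if l = i then M $ i $ m else 0)" for i l m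
      by (cases "l = i") (simp_all add: axis_def if_distrib[of "\<lambda>x. _ * x"] cong: if_cong)
    then show ?thesis
      by (simp add: vec_eq_iff)
  qed
  then have "f = (\<lambda>x. \<Sum>i\<in>UNIV. \<Sum>j\<in>UNIV. f x $ i $ j *\<^sub>R axis i (axis j 1))"
    by simp
  moreover have "Ck_on k V U (\<lambda>x. \<Sum>i\<in>UNIV. \<Sum>j\<in>UNIV. f x $ i $ j *\<^sub>R (axis i (axis j 1) :: 'n sqmat))"
    by (intro Ck_on_sum finite Ck_on_compose_linear[OF bounded_linear_scaleR_left assms])
  ultimately show ?thesis by simp
qed

lemma Ck_on_entry: "Ck_on k V U (\<lambda>A :: ('n :: finite) sqmat. A $ i $ j)"
  by (intro Ck_on_linear bounded_linear_compose[OF bounded_linear_vec_nth] bounded_linear_vec_nth)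

lemma arith_funs_Ck_on:
  assumes "f \<in> arith_funs D" and D: "\<And>A. A \<in> U \<Longrightarrow> (A, B) \<in> D"
  shows "Ck_on k V U (\<lambda>A. f (A, B))"
  using assms(1)
proof (induction rule: arith_funs.induct)
  case (divide f g)
  then show ?case using D by (intro Ck_on_divide) auto
next
  case (sqrt f)
  then show ?case using D by (intro Ck_on_sqrt) auto
qed (simp_all add: Ck_on_entry Ck_on_const Ck_on_add Ck_on_diff Ck_on_mult)

lemma Ck_on_congruence_map: "Ck_on k V U (congruence_map B)"
  by (rule Ck_on_matrix, unfold congruence_map_nth)
    (intro Ck_on_sum Ck_on_mult Ck_on_entry Ck_on_const finite)

text \<open>On \<open>LPM \<epsilon>\<close> the abstract inverse agrees with the explicit one,
  whose entries are arithmetic functions.\<close>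

lemma Ck_on_congruence_inverse:
  assumes B: "B \<in> LPM \<epsilon>"
  shows "Ck_on k V (LPM \<epsilon>) (inv_into cholesky_space (congruence_map B))"
proof -
  have "Ck_on k V (LPM \<epsilon>) (congruence_inverse B)"
  proof (rule Ck_on_matrix)
    fix i j
    have "Ck_on k V (LPM \<epsilon>) (\<lambda>A. congruence_inverse (snd (A, B)) (fst (A, B)) $ i $ j)"
      by (rule arith_funs_Ck_on[OF arith_funs_congruence_inverse])
        (use B in \<open>auto simp: same_pattern_pairs_def\<close>)
    then show "Ck_on k V (LPM \<epsilon>) (\<lambda>A. congruence_inverse B A $ i $ j)"
      by simp
  qed
  then show ?thesis
    by (rule Ck_on_cong[THEN iffD1, rotated]) (simp add: inv_into_congruence_map[OF _ B])
qed

section \<open>Relative openness of the domain and the range\<close>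

lemma subspace_lower_triangular: "subspace lower_triangular_matrices"
  by (auto simp: subspace_def lower_triangular_matrices_def)

lemma subspace_symmetric: "subspace symmetric_matrices"
  by (auto simp: subspace_def symmetric_matrices_def transpose_def vec_eq_iff)

lemma openin_cholesky_space:
  "openin (top_of_set lower_triangular_matrices) (cholesky_space :: ('n :: {finite, linorder}) sqmat set)"
proof -
  have "open {L :: 'n sqmat. 0 < L $ i $ i}" for i
    by (intro open_Collect_less continuous_intros)
  then have op: "open (\<Inter>i. {L :: 'n sqmat. 0 < L $ i $ i})"
    by (intro open_INT) auto
  have eq: "cholesky_space = lower_triangular_matrices \<inter> (\<Inter>i. {L :: 'n sqmat. 0 < L $ i $ i})"
    by (auto simp: cholesky_space_def)
  show ?thesis
    unfolding eq by (rule openin_open_Int[OF op])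
qed

lemma continuous_on_leading_principal_minor: "continuous_on S (leading_principal_minor k)"
  unfolding leading_principal_minor_def principal_minor_def by (intro continuous_intros)

lemma openin_LPM:
  assumes "\<epsilon> \<in> sign_patterns"
  shows "openin (top_of_set symmetric_matrices) (LPM \<epsilon> :: ('n :: {finite, linorder}) sqmat set)"
proof -
  have "open {A :: 'n sqmat. 0 < \<epsilon> k * leading_principal_minor k A}" for k
    by (intro open_Collect_less continuous_intros continuous_on_leading_principal_minor)
  then have op: "open (\<Inter>k. {A. 0 < \<epsilon> k * leading_principal_minor k A})"
    by (intro open_INT) auto
  \<comment> \<open>Multiplying by the prescribed sign turns the sign condition into one strict
    inequality, which is an open condition.\<close>
  have "x \<noteq> 0 \<and> sgn x = \<epsilon> k \<longleftrightarrow> 0 < \<epsilon> k * x" for x k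
  proof -
    have "\<epsilon> k = -1 \<or> \<epsilon> k = 1"
      using assms by (simp add: sign_patterns_def)
    then show ?thesis by (elim disjE) (simp_all add: sgn_if)
  qed
  then have eq: "LPM \<epsilon> = symmetric_matrices \<inter> (\<Inter>k. {A. 0 < \<epsilon> k * leading_principal_minor k A})"
    unfolding LPM_def by auto
  show ?thesis
    unfolding eq by (rule openin_open_Int[OF op])
qed

lemma diffeomorphism_congruence_map:
  assumes "\<epsilon> \<in> sign_patterns" "B \<in> LPM \<epsilon>"
  shows "diffeomorphism_on lower_triangular_matrices cholesky_space
    symmetric_matrices (LPM \<epsilon>) (congruence_map B)"
  unfolding diffeomorphism_on_def smooth_on_def
  using assms
  by (intro conjI allI bij_betw_congruence_map subspace_lower_triangular subspace_symmetric
      openin_cholesky_space openin_LPM Ck_on_congruence_map Ck_on_congruence_inverse)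


section \<open>Borel and Lebesgue sets\<close>

text \<open>The image under \<open>f\<close> is the preimage under its continuous inverse
  \<open>g\<close>.\<close>

lemma borel_sets_in_image:
  assumes S: "S \<in> borel_sets_in U" and g: "continuous_on U' g"
    and gf: "\<And>x. x \<in> U \<Longrightarrow> f x \<in> U' \<and> g (f x) = x"
    and fg: "\<And>y. y \<in> U' \<Longrightarrow> g y \<in> U \<and> f (g y) = y"
  shows "f ` S \<in> borel_sets_in U'"
proof -
  have "S \<subseteq> U"
    using sets.sets_into_space[OF S[unfolded borel_sets_in_def]] by (simp add: space_restrict_space)
  have "g \<in> measurable (restrict_space borel U') (restrict_space borel U)"
    using fg by (intro measurable_restrict_space2 borel_measurable_continuous_on_restrict g)
      (auto simp: space_restrict_space)
  from measurable_sets[OF this S[unfolded borel_sets_in_def]]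
  have "g -` S \<inter> U' \<in> borel_sets_in U'"
    by (simp add: borel_sets_in_def space_restrict_space)
  moreover have "g -` S \<inter> U' = f ` S"
  proof (intro equalityI subsetI)
    fix y assume "y \<in> g -` S \<inter> U'"
    then have "g y \<in> S" "y = f (g y)" using fg[of y] by auto
    then show "y \<in> f ` S" by (rule rev_image_eqI)
  next
    fix y assume "y \<in> f ` S"
    then obtain x where "x \<in> S" "y = f x" by blast
    then show "y \<in> g -` S \<inter> U'" using gf[of x] \<open>S \<subseteq> U\<close> by auto
  qed
  ultimately show ?thesis by simp
qed

lemma linear_lower_entries: "linear lower_entries"
  by (rule linearI) (simp_all add: lower_entries_def vec_eq_iff)

text \<open>A linear way back from coordinates to matrices, used to transport maps to the coordinate
  space.\<close>

lemma lower_triangular_section: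
  obtains s :: "(real, 'n :: {finite, linorder} tri) vec \<Rightarrow> 'n sqmat"
  where "linear s" "\<And>A. A \<in> lower_triangular_matrices \<Longrightarrow> s (lower_entries A) = A"
proof
  let ?s = "\<lambda>x :: (real, 'n tri) vec. (\<chi> i j. if j \<le> i then x $ Abs_tri (i, j) else 0) :: 'n sqmat"
  show "linear ?s"
    by (rule linearI) (simp_all add: vec_eq_iff)
  show "?s (lower_entries A) = A" if "A \<in> lower_triangular_matrices" for A
    using that by (auto simp: vec_eq_iff lower_entries_def Abs_tri_inverse lower_triangular_matrices_def)
qed

lemma symmetric_section:
  obtains s :: "(real, 'n :: {finite, linorder} tri) vec \<Rightarrow> 'n sqmat"
  where "linear s" "\<And>A. A \<in> symmetric_matrices \<Longrightarrow> s (lower_entries A) = A"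
proof
  let ?s = "\<lambda>x :: (real, 'n tri) vec.
    (\<chi> i j. if j \<le> i then x $ Abs_tri (i, j) else x $ Abs_tri (j, i)) :: 'n sqmat"
  show "linear ?s"
    by (rule linearI) (simp_all add: vec_eq_iff)
  show "?s (lower_entries A) = A" if "A \<in> symmetric_matrices" for A
    using that by (auto simp: vec_eq_iff lower_entries_def Abs_tri_inverse symmetric_matrices_def transpose_def)
qed

text \<open>In coordinates \<open>f\<close> becomes a differentiable map within one Euclidean space,
  and such maps send Lebesgue sets to Lebesgue sets. Continuity alone would not guarantee
  this.\<close>

lemma lebesgue_sets_in_image:
  fixes f :: "('n :: {finite, linorder}) sqmat \<Rightarrow> 'n sqmat"
  assumes S: "S \<in> lebesgue_sets_in U" and f: "f differentiable_on U" and im: "f ` U \<subseteq> U'"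
    and s: "linear s" "\<And>A. A \<in> U \<Longrightarrow> s (lower_entries A) = A"
  shows "f ` S \<in> lebesgue_sets_in U'"
proof -
  have "S \<subseteq> U" and leb: "lower_entries ` S \<in> sets lebesgue"
    using S by (auto simp: lebesgue_sets_in_def)
  have "(\<lambda>x. s (lower_entries x)) ` S = S"
    using image_cong[of S S "\<lambda>x. s (lower_entries x)" "\<lambda>x. x"] s(2) subsetD[OF \<open>S \<subseteq> U\<close>]
    by (simp only: image_ident)
  then have sS: "s ` lower_entries ` S = S"
    by (simp add: image_image)
  have "(\<lambda>x. f (s x)) differentiable_on lower_entries ` S"
    by (rule differentiable_on_compose[OF linear_imp_differentiable_on[OF s(1)]])
      (simp only: sS differentiable_on_subset[OF f \<open>S \<subseteq> U\<close>])
  then have "(\<lambda>x. lower_entries (f (s x))) differentiable_on lower_entries ` S"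
    by (rule differentiable_on_compose) (rule linear_imp_differentiable_on[OF linear_lower_entries])
  then have "(\<lambda>x. lower_entries (f (s x))) ` lower_entries ` S \<in> sets lebesgue"
    by (rule differentiable_image_in_sets_lebesgue[OF leb order_refl])
  also have "(\<lambda>x. lower_entries (f (s x))) ` lower_entries ` S = lower_entries ` f ` s ` lower_entries ` S"
    by (simp add: image_image)
  finally show ?thesis
    using \<open>S \<subseteq> U\<close> im unfolding sS lebesgue_sets_in_def by blast
qed

lemma congruence_map_inverse_on:
  assumes B: "B \<in> LPM \<epsilon>"
  shows "\<And>L. L \<in> cholesky_space \<Longrightarrow> congruence_map B L \<in> LPM \<epsilon> \<and>
      inv_into cholesky_space (congruence_map B) (congruence_map B L) = L"
    and "\<And>A. A \<in> LPM \<epsilon> \<Longrightarrow> inv_into cholesky_space (congruence_map B) A \<in> cholesky_space \<and>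
      congruence_map B (inv_into cholesky_space (congruence_map B) A) = A"
  using congruence_map_LPM[OF B] inv_into_f_f[OF congruence_map_inj_on[OF B]]
    congruence_inverse_cholesky[OF _ B] congruence_map_inverse[OF _ B] inv_into_congruence_map[OF _ B]
  by auto

lemma image_inv_congruence_map:
  assumes "B \<in> LPM \<epsilon>" "S \<subseteq> cholesky_space"
  shows "inv_into cholesky_space (congruence_map B) ` congruence_map B ` S = S"
  using assms by (intro inv_into_image_cancel congruence_map_inj_on)

lemma borel_sets_congruence_map:
  assumes B: "B \<in> LPM \<epsilon>" and S: "S \<subseteq> cholesky_space"
  shows "S \<in> borel_sets_in cholesky_space \<longleftrightarrow> congruence_map B ` S \<in> borel_sets_in (LPM \<epsilon>)"
proof
  have cont: "continuous_on (LPM \<epsilon>) (inv_into cholesky_space (congruence_map B))"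
    using Ck_on_congruence_inverse[OF B, of 0] by simp
  show "congruence_map B ` S \<in> borel_sets_in (LPM \<epsilon>)" if "S \<in> borel_sets_in cholesky_space"
    by (rule borel_sets_in_image[OF that cont congruence_map_inverse_on[OF B]])
next
  assume "congruence_map B ` S \<in> borel_sets_in (LPM \<epsilon>)"
  moreover have "continuous_on cholesky_space (congruence_map B)"
    using Ck_on_congruence_map[of 0 UNIV cholesky_space B] by simp
  ultimately have "inv_into cholesky_space (congruence_map B) ` congruence_map B ` S
      \<in> borel_sets_in cholesky_space"
    by (rule borel_sets_in_image) (fact congruence_map_inverse_on[OF B])+
  then show "S \<in> borel_sets_in cholesky_space"
    by (simp only: image_inv_congruence_map[OF assms])
qed

lemma Ck_on_imp_differentiable_on: "Ck_on (Suc k) V U f \<Longrightarrow> f differentiable_on U"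
  unfolding Ck_on.simps differentiable_on_def differentiable_def by blast

lemma lebesgue_sets_congruence_map:
  assumes B: "B \<in> LPM \<epsilon>" and S: "S \<subseteq> cholesky_space"
  shows "S \<in> lebesgue_sets_in cholesky_space \<longleftrightarrow> congruence_map B ` S \<in> lebesgue_sets_in (LPM \<epsilon>)"
proof
  assume leb: "S \<in> lebesgue_sets_in cholesky_space"
  obtain s :: "(real, 'a tri) vec \<Rightarrow> 'a sqmat"
    where s: "linear s" "\<And>A. A \<in> lower_triangular_matrices \<Longrightarrow> s (lower_entries A) = A"
    using lower_triangular_section by blast
  show "congruence_map B ` S \<in> lebesgue_sets_in (LPM \<epsilon>)"
  proof (rule lebesgue_sets_in_image[OF leb Ck_on_imp_differentiable_on[OF Ck_on_congruence_map] _ s(1)])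
    show "congruence_map B ` cholesky_space \<subseteq> LPM \<epsilon>"
      using congruence_map_LPM[OF B] by blast
  qed (use s(2) in \<open>auto simp: cholesky_space_def\<close>)
next
  assume leb: "congruence_map B ` S \<in> lebesgue_sets_in (LPM \<epsilon>)"
  obtain s :: "(real, 'a tri) vec \<Rightarrow> 'a sqmat"
    where s: "linear s" "\<And>A. A \<in> symmetric_matrices \<Longrightarrow> s (lower_entries A) = A"
    using symmetric_section by blast
  have "inv_into cholesky_space (congruence_map B) ` congruence_map B ` S \<in> lebesgue_sets_in cholesky_space"
  proof (rule lebesgue_sets_in_image[OF leb Ck_on_imp_differentiable_on[OF Ck_on_congruence_inverse[OF B]] _ s(1)])
    show "inv_into cholesky_space (congruence_map B) ` LPM \<epsilon> \<subseteq> cholesky_space"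
      using congruence_map_inverse_on(2)[OF B] by blast
  qed (use s(2) LPM_D(1) in blast)
  then show "S \<in> lebesgue_sets_in cholesky_space"
    by (simp only: image_inv_congruence_map[OF assms])
qed


section \<open>The sign patterns fill the symmetric matrices densely\<close>

lemma LPM_union_eq:
  "LPM_union = {A \<in> symmetric_matrices. \<forall>k. leading_principal_minor k A \<noteq> 0}"
proof (intro equalityI subsetI)
  fix A :: "'a sqmat"
  assume "A \<in> {A \<in> symmetric_matrices. \<forall>k. leading_principal_minor k A \<noteq> 0}"
  then have "A \<in> LPM (\<lambda>k. sgn (leading_principal_minor k A))"
    and "(\<lambda>k. sgn (leading_principal_minor k A)) \<in> sign_patterns"
    by (auto simp: LPM_def sign_patterns_def sgn_if)
  then show "A \<in> LPM_union"
    unfolding LPM_union_def by blast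
qed (auto simp: LPM_union_def LPM_def)

text \<open>A diagonal matrix of signs suffices: each entry is the quotient of two consecutive
  prescribed signs, so the minors telescope.\<close>

lemma LPM_nonempty:
  fixes \<epsilon> :: "'n :: {finite, linorder} \<Rightarrow> real"
  assumes \<epsilon>: "\<epsilon> \<in> sign_patterns"
  shows "LPM \<epsilon> \<noteq> {}"
proof -
  \<comment> \<open>\<open>e k\<close> is the sign at the predecessor of \<open>k\<close>, and 1 at
    the least index, where the product of the earlier entries is empty.\<close>
  define e where "e k = (if {..<k} = {} then 1 else \<epsilon> (Max {..<k}))" for k
  have sign: "\<epsilon> k \<in> {-1, 1}" "e k \<in> {-1, 1}" for k
    using \<epsilon> by (auto simp: sign_patterns_def e_def)
  have prod: "(\<Prod>j\<in>{..k}. \<epsilon> j * e j) = \<epsilon> k" for k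
  proof (induction k rule: finite_less_induct)
    case (less k)
    have "(\<Prod>j\<in>{..<k}. \<epsilon> j * e j) = e k"
    proof (cases "{..<k} = {}")
      case False
      define m where "m = Max {..<k}"
      have "m < k"
        using Max_in[OF _ False] by (simp add: m_def)
      moreover have "j \<le> m" if "j < k" for j
        using that by (simp add: m_def)
      ultimately have "{..<k} = {..m}"
        by (auto intro: le_less_trans)
      then have "(\<Prod>j\<in>{..<k}. \<epsilon> j * e j) = \<epsilon> m"
        using less[OF \<open>m < k\<close>] by (simp only:)
      also have "\<epsilon> m = e k"
        using False by (simp only: e_def m_def if_False)
      finally show ?thesis .
    qed (simp add: e_def)
    moreover have "{..k} = insert k {..<k}"
      by auto
    moreover have "e k * e k = 1"
      using sign(2)[of k] by auto
    ultimately show ?case by simp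
  qed
  have "\<epsilon> k \<noteq> 0 \<and> sgn (\<epsilon> k) = \<epsilon> k" for k
    using sign(1)[of k] by auto
  then have "diag (\<lambda>j. \<epsilon> j * e j) \<in> LPM \<epsilon>"
    by (simp only: LPM_def mem_Collect_eq leading_principal_minor_diag prod diag_symmetric simp_thms)
  then show ?thesis by blast
qed

lemma disjoint_LPM: "disjoint_family_on LPM sign_patterns"
proof -
  have "\<epsilon> k = \<epsilon>' k" if "A \<in> LPM \<epsilon>" "A \<in> LPM \<epsilon>'" for A :: "'a sqmat" and \<epsilon> \<epsilon>' k
    using LPM_D(3)[OF that(1), of k] LPM_D(3)[OF that(2), of k] by simp
  then show ?thesis
    unfolding disjoint_family_on_def by blast
qed

lemma openin_LPM_union: "openin (top_of_set symmetric_matrices) LPM_union"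
  unfolding LPM_union_def by (intro openin_Union) (auto simp: openin_LPM)

lemma leading_principal_minor_scale:
  "leading_principal_minor k (c *\<^sub>R A) = c ^ card {..k} * leading_principal_minor k A"
  by (simp add: leading_principal_minor_def principal_minor_def prod.distrib sum_distrib_left mult_ac)

lemma mat_1_eq_diag: "mat 1 = diag (\<lambda>_. 1)"
  by (simp add: mat_def diag_def)

text \<open>In the reversed variable the constant term is \<open>1\<close>, so the polynomial is visibly nonzero.\<close>

lemma leading_principal_minor_poly:
  obtains q where "q \<noteq> 0" "\<And>s. poly q s = leading_principal_minor k (mat 1 + s *\<^sub>R A)"
proof
  \<comment> \<open>The Leibniz sum with each entry of \<open>mat 1 + s *\<^sub>R A\<close> read as
    a polynomial in \<open>s\<close> of degree at most one.\<close>
  define q where "q = (\<Sum>p | p permutes {..k}.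
    [:of_int (sign p):] * (\<Prod>i\<in>{..k}. [: mat 1 $ i $ p i, A $ i $ p i :]))"
  show q: "poly q s = leading_principal_minor k (mat 1 + s *\<^sub>R A)" for s
    by (simp add: q_def leading_principal_minor_def principal_minor_def poly_sum poly_prod)
  have "leading_principal_minor k (mat 1) = 1"
    by (simp add: mat_1_eq_diag leading_principal_minor_diag)
  then show "q \<noteq> 0"
    using q[of 0] by auto
qed

text \<open>For \<open>t \<noteq> 0\<close>, scaling by \<open>inverse t\<close> turns a zero at
  \<open>t\<close> into a root of a nonzero polynomial at \<open>inverse t\<close>; the value
  \<open>t = 0\<close> adds at most one more.\<close>

lemma finite_singular_shifts:
  "finite {t. leading_principal_minor k (A + t *\<^sub>R mat 1) = 0}"
proof -
  obtain q where q: "q \<noteq> 0" "\<And>s. poly q s = leading_principal_minor k (mat 1 + s *\<^sub>R A)"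
    using leading_principal_minor_poly[of k A] by blast
  have "t = 0 \<or> t \<in> inverse ` {s. poly q s = 0}"
    if "leading_principal_minor k (A + t *\<^sub>R mat 1) = 0" for t
  proof (cases "t = 0")
    case False
    have "leading_principal_minor k (inverse t *\<^sub>R (A + t *\<^sub>R mat 1)) = 0"
      using that by (simp only: leading_principal_minor_scale mult_zero_right)
    also have "inverse t *\<^sub>R (A + t *\<^sub>R mat 1) = mat 1 + inverse t *\<^sub>R A"
      using False by (simp add: scaleR_add_right add.commute)
    finally have "poly q (inverse t) = 0"
      by (simp only: q)
    then show ?thesis
      by (intro disjI2 image_eqI[of _ _ "inverse t"]) simp_all
  qed simp
  then have "{t. leading_principal_minor k (A + t *\<^sub>R mat 1) = 0} \<subseteq> insert 0 (inverse ` {s. poly q s = 0})"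
    by blast
  then show ?thesis
    using poly_roots_finite[OF q(1)] by (auto intro: finite_subset)
qed

lemma closure_LPM_union:
  fixes A :: "('n :: {finite, linorder}) sqmat"
  assumes sym: "A \<in> symmetric_matrices"
  shows "A \<in> closure LPM_union"
proof (rule Lim_in_closed_set)
  let ?f = "\<lambda>t. A + t *\<^sub>R mat 1"
  let ?bad = "\<Union>k. {t. leading_principal_minor k (?f t) = 0}"
  have "finite ?bad"
    by (intro finite_UN_I finite finite_singular_shifts)
  \<comment> \<open>A finite set has no limit point, so all small nonzero shifts are good, even if 0
    itself is bad.\<close>
  then have "eventually (\<lambda>t. t \<notin> ?bad) (at 0)"
    using islimpt_finite islimpt_iff_eventually by blast
  moreover have "?f t \<in> closure LPM_union" if "t \<notin> ?bad" for t
  proof -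
    have "?f t \<in> symmetric_matrices"
      unfolding mat_1_eq_diag
      by (intro subspace_add subspace_scale subspace_symmetric sym diag_symmetric)
    then have "?f t \<in> LPM_union"
      using that by (simp add: LPM_union_eq)
    then show ?thesis
      using closure_subset by blast
  qed
  ultimately show "eventually (\<lambda>t. ?f t \<in> closure LPM_union) (at 0)"
    by (rule eventually_mono)
  have "(?f \<longlongrightarrow> A + 0 *\<^sub>R mat 1) (at 0)"
    by (intro tendsto_intros)
  then show "(?f \<longlongrightarrow> A) (at 0)"
    by simp
qed simp_all

lemma finite_sign_patterns: "finite (sign_patterns :: ('n :: finite \<Rightarrow> real) set)"
proof -
  have eq: "sign_patterns = (PiE UNIV (\<lambda>_. {-1, 1}) :: ('n \<Rightarrow> real) set)"
    by (auto simp: sign_patterns_def PiE_UNIV_domain)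
  show ?thesis
    unfolding eq by (intro finite_PiE) auto
qed

text \<open>A finite union of closures is closed and contains \<open>LPM_union\<close>, so it
  contains every symmetric matrix by density.\<close>

lemma closure_single_pattern:
  assumes "A \<in> symmetric_matrices"
  obtains \<epsilon> where "\<epsilon> \<in> sign_patterns" "A \<in> closure (LPM \<epsilon>)"
proof -
  have "closed (\<Union>\<epsilon>\<in>sign_patterns. closure (LPM \<epsilon> :: 'a sqmat set))"
    by (intro closed_UN finite_sign_patterns) simp
  moreover have "LPM_union \<subseteq> (\<Union>\<epsilon>\<in>sign_patterns. closure (LPM \<epsilon>))"
    unfolding LPM_union_def using closure_subset by blast
  ultimately show ?thesis
    using closure_minimal closure_LPM_union[OF assms] that by blast
qed

theorem theorem1:
  shows
    "((\<forall>\<epsilon>\<in>sign_patterns. LPM \<epsilon> \<noteq> ({} :: ('n :: {finite, linorder}) sqmat set)) \<and>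
      disjoint_family_on (LPM :: ('n \<Rightarrow> real) \<Rightarrow> 'n sqmat set) sign_patterns \<and>
      openin (top_of_set symmetric_matrices) (LPM_union :: 'n sqmat set) \<and>
      (top_of_set symmetric_matrices) closure_of (LPM_union :: 'n sqmat set)
        = symmetric_matrices \<and>
      (\<forall>A \<in> (symmetric_matrices :: 'n sqmat set).
         \<exists>\<epsilon>\<in>sign_patterns. \<exists>X :: nat \<Rightarrow> 'n sqmat.
           (\<forall>m. X m \<in> LPM \<epsilon>) \<and>
           (\<forall>i j. (\<lambda>m. X m $ i $ j) \<longlonglongrightarrow> A $ i $ j)))
     \<and>
     ((\<forall>\<epsilon>\<in>sign_patterns. \<forall>B \<in> (LPM \<epsilon> :: 'n sqmat set).
         congruence_map B \<in> cholesky_space \<rightarrow> LPM \<epsilon> \<and>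
         diffeomorphism_on lower_triangular_matrices cholesky_space
           symmetric_matrices (LPM \<epsilon>) (congruence_map B) \<and>
         (\<forall>S \<subseteq> cholesky_space.
            (S \<in> borel_sets_in cholesky_space \<longleftrightarrow>
               congruence_map B ` S \<in> borel_sets_in (LPM \<epsilon>)) \<and>
            (S \<in> lebesgue_sets_in cholesky_space \<longleftrightarrow>
               congruence_map B ` S \<in> lebesgue_sets_in (LPM \<epsilon>)))) \<and>
      (\<exists>(P :: 'n instr list) out.
         \<forall>\<epsilon>\<in>sign_patterns. \<forall>B \<in> LPM \<epsilon>. \<forall>A \<in> LPM \<epsilon>.
           program_computes P out A B (inv_into cholesky_space (congruence_map B) A)))"
proof (intro conjI ballI allI impI)
  show "LPM \<epsilon> \<noteq> ({} :: 'n sqmat set)" if "\<epsilon> \<in> sign_patterns" for \<epsilon>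
    by (rule LPM_nonempty[OF that])
  show "disjoint_family_on (LPM :: ('n \<Rightarrow> real) \<Rightarrow> 'n sqmat set) sign_patterns"
    by (rule disjoint_LPM)
  show "openin (top_of_set symmetric_matrices) (LPM_union :: 'n sqmat set)"
    by (rule openin_LPM_union)
  have "symmetric_matrices \<inter> LPM_union = (LPM_union :: 'n sqmat set)"
    by (auto simp: LPM_union_eq)
  then show "(top_of_set symmetric_matrices) closure_of (LPM_union :: 'n sqmat set) = symmetric_matrices"
    using closure_LPM_union by (auto simp: closure_of_subtopology)
  show "\<exists>\<epsilon>\<in>sign_patterns. \<exists>X :: nat \<Rightarrow> 'n sqmat. (\<forall>m. X m \<in> LPM \<epsilon>) \<and>
      (\<forall>i j. (\<lambda>m. X m $ i $ j) \<longlonglongrightarrow> A $ i $ j)"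
    if A: "A \<in> symmetric_matrices" for A :: "'n sqmat"
  proof -
    obtain \<epsilon> where \<epsilon>: "\<epsilon> \<in> sign_patterns" "A \<in> closure (LPM \<epsilon>)"
      using closure_single_pattern[OF A] by blast
    \<comment> \<open>A point of the closure is a limit of a sequence in the set, here in a single
      \<open>LPM \<epsilon>\<close>.\<close>
    then obtain X where "\<forall>m. X m \<in> LPM \<epsilon>" "X \<longlonglongrightarrow> A"
      unfolding closure_sequential by blast
    then show ?thesis
      by (intro bexI[OF _ \<epsilon>(1)] exI[of _ X] conjI allI tendsto_vec_nth) simp_all
  qed
  show "\<exists>(P :: 'n instr list) out. \<forall>\<epsilon>\<in>sign_patterns. \<forall>B \<in> LPM \<epsilon>. \<forall>A \<in> LPM \<epsilon>.
      program_computes P out A B (inv_into cholesky_space (congruence_map B) A)"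
  proof -
    obtain P :: "'n instr list" and out where
      "\<And>\<epsilon> A B. B \<in> LPM \<epsilon> \<Longrightarrow> A \<in> LPM \<epsilon> \<Longrightarrow> program_computes P out A B (congruence_inverse B A)"
      using congruence_inverse_program by blast
    then show ?thesis
      by (intro exI[of _ P] exI[of _ out] ballI) (simp only: inv_into_congruence_map)
  qed
next
  fix \<epsilon> :: "'n \<Rightarrow> real" and B :: "'n sqmat"
  assume \<epsilon>: "\<epsilon> \<in> sign_patterns" and B: "B \<in> LPM \<epsilon>"
  show "congruence_map B \<in> cholesky_space \<rightarrow> LPM \<epsilon>"
    using congruence_map_LPM[OF B] by blast
  show "diffeomorphism_on lower_triangular_matrices cholesky_space
      symmetric_matrices (LPM \<epsilon>) (congruence_map B)"
    by (rule diffeomorphism_congruence_map[OF \<epsilon> B])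
  fix S :: "'n sqmat set"
  assume S: "S \<subseteq> cholesky_space"
  show "S \<in> borel_sets_in cholesky_space \<longleftrightarrow> congruence_map B ` S \<in> borel_sets_in (LPM \<epsilon>)"
    by (rule borel_sets_congruence_map[OF B S])
  show "S \<in> lebesgue_sets_in cholesky_space \<longleftrightarrow> congruence_map B ` S \<in> lebesgue_sets_in (LPM \<epsilon>)"
    by (rule lebesgue_sets_congruence_map[OF B S])
qed

end
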